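(* Let $A=K\langle x_1,\dots,x_n\rangle/I$ be a monomial algebra over the field $K$, where $I$ is generated by a minimal finite set $R$ of monic monomials. Then $A$ is $\mathcal{K}_2$ if and only if the following condition holds for every $b\in S$: whenever $a\in LE(R)$ satisfies $L(a,b)=a$, then $ab\in R$ or $\deg(a)=1$.
   Context: Conventions. $K$ is a field. A "graded algebra" is a connected $\mathbb{N}$-graded $K$-algebra of the form $A=T(V)/I$, where $V$ is a finite-dimensional $K$-vector space placed in degree 1, $T(V)$ is its tensor algebra, and $I$ is an ideal generated by a (minimal) finite set of homogeneous elements of degree at least 2 (not necessarily all of the same degree). The field $K$ is identified with the trivial $A$-module $A/A_+$. The bigraded Yoneda algebra is $E(A)=\bigoplus_{n,m} E^{n,m}(A)$ with $E^{n,m}(A)=\mathrm{Ext}_A^{n}(K,K)_{-m}$ ($n$ is the cohomological degree, $-m$ the internal degree; Ext is computed in the category of $\mathbb{Z}$-graded locally finite $A$-modules with graded Hom spaces), with the Yoneda (cup) product; $E^n(A)=\bigoplus_m E^{n,m}(A)$. The graded algebra $A$ is called $\mathcal{K}_2$ if $E(A)$ is generated as an algebra by $E^1(A)$ and $E^2(A)$. Monomial notation. $\{x_1,\dots,x_n\}$ is a fixed basis of $V$, $T=T(V)=K\langle x_1,\dots,x_n\rangle$, and $R=\{r_1,\dots,r_s\}$ is a minimal finite set of monic monomials in the $x_i$, of degree at least 2, generating $I$. For $a\in T$, $\bar a$ is its image in $A$. $T_{mon}$ is the set of monic monomials in $T$; $|a|=\deg(a)$ is the degree of $a\in T_{mon}$.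 $LE(R)$ is the set of all $a\in T_{mon}$ for which there is $b\in T_{mon}$ with $|b|>0$ and $ab\in R$ (proper left ends of elements of $R$). For $a,b\in T_{mon}$ with $\overline{ab}=0$, $L(a,b)$ is the monic monomial $a'$ such that $a=a''a'$ for some $a''\in T_{mon}$ and $a'$ is minimal (shortest) with $\overline{a'b}=0$; if $\overline{ab}\ne 0$, set $L(a,b)=0$. Finally, $S$ is the smallest subset of $T$ such that (1) each $x_i\in S$, and (2) if $b\in S$ and $L(a,b)=a$ for some $a\in LE(R)$, then $a\in S$. *)

theory Defs
  imports Complex_Main "HOL-Library.Poly_Mapping" "HOL-Library.Sublist"
begin

section \<open>The free algebra\<close>

text \<open>Words under concatenation are the free monoid. With this instance, the convolution product
  of \<^theory>\<open>HOL-Library.Poly_Mapping\<close> makes \<^typ>\<open>'x list \<Rightarrow>\<^sub>0 'k\<close> the free algebra on the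
  letters \<^typ>\<open>'x\<close>, i.e. the tensor algebra of the vector space with basis \<^typ>\<open>'x\<close>.\<close>

instantiation list :: (type) monoid_add
begin
definition zero_list :: "'a list" where "zero_list = []"
definition plus_list :: "'a list \<Rightarrow> 'a list \<Rightarrow> 'a list" where "plus_list = (@)"
instance by standard (simp_all add: zero_list_def plus_list_def)
end

type_synonym ('x, 'k) free_alg = "'x list \<Rightarrow>\<^sub>0 'k"

definition mon :: "'x list \<Rightarrow> ('x, 'k::field) free_alg"
  where "mon w = Poly_Mapping.single w 1"

definition scalar :: "'k::field \<Rightarrow> ('x, 'k) free_alg"
  where "scalar c = Poly_Mapping.single [] c"

definition homog :: "nat \<Rightarrow> ('x, 'k::field) free_alg set"
  where "homog d = {a. \<forall>w\<in>Poly_Mapping.keys a. length w = d}"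

definition two_sided_ideal :: "('x, 'k::field) free_alg set \<Rightarrow> bool"
  where "two_sided_ideal J \<longleftrightarrow>
    0 \<in> J \<and> (\<forall>a\<in>J. \<forall>b\<in>J. a + b \<in> J) \<and> (\<forall>a\<in>J. \<forall>s t. s * a * t \<in> J)"

definition ideal_gen :: "('x, 'k::field) free_alg set \<Rightarrow> ('x, 'k) free_alg set"
  where "ideal_gen G = two_sided_ideal hull G"

lemma mon_Nil: "mon [] = 1"
  by (simp add: mon_def flip: zero_list_def)

lemma mon_append: "mon (u @ v) = mon u * mon v"
  by (simp add: mon_def mult_single plus_list_def)

lemma two_sided_ideal_ideal_gen: "two_sided_ideal (ideal_gen G)"
  unfolding ideal_gen_def by (rule hull_in) (auto simp: two_sided_ideal_def)


section \<open>Graded modules\<close>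

text \<open>Throughout, \<open>I\<close> is an ideal of the free algebra \<open>T\<close> and the algebra in question is \<open>A = T / I\<close>.
  A left module over \<open>A\<close> is a left module over \<open>T\<close> on which \<open>I\<close> acts as zero. The internally graded
  modules below are given by their homogeneous pieces; the underlying set is the sum of the pieces.
  The action is irrelevant outside of that set, and scalars of the field act through
  \<^const>\<open>scalar\<close>.\<close>

record (overloaded) ('x, 'k::zero, 'm) gmod =
  piece :: "int \<Rightarrow> 'm set"
  act :: "('x, 'k) free_alg \<Rightarrow> 'm \<Rightarrow> 'm"

definition carr :: "('x, 'k::field, 'm::ab_group_add) gmod \<Rightarrow> 'm set"
  where "carr M = {m. \<exists>J c. finite J \<and> (\<forall>j\<in>J. c j \<in> piece M j) \<and> m = (\<Sum>j\<in>J. c j)}"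

definition graded_module ::
  "('x, 'k::field) free_alg set \<Rightarrow> ('x, 'k, 'm::ab_group_add) gmod \<Rightarrow> bool"
  where "graded_module I M \<longleftrightarrow>
    (\<forall>j. 0 \<in> piece M j \<and> (\<forall>m\<in>piece M j. \<forall>m'\<in>piece M j. m + m' \<in> piece M j)) \<and>
    (\<forall>J c. finite J \<longrightarrow> (\<forall>j\<in>J. c j \<in> piece M j) \<longrightarrow> (\<Sum>j\<in>J. c j) = 0 \<longrightarrow> (\<forall>j\<in>J. c j = 0)) \<and>
    (\<forall>d. \<forall>a\<in>homog d. \<forall>j. \<forall>m\<in>piece M j. act M a m \<in> piece M (int d + j)) \<and>
    (\<forall>a. \<forall>m\<in>carr M. \<forall>m'\<in>carr M. act M a (m + m') = act M a m + act M a m') \<and>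
    (\<forall>a b. \<forall>m\<in>carr M. act M (a + b) m = act M a m + act M b m) \<and>
    (\<forall>a b. \<forall>m\<in>carr M. act M (a * b) m = act M a (act M b m)) \<and>
    (\<forall>m\<in>carr M. act M 1 m = m) \<and>
    (\<forall>a\<in>I. \<forall>m\<in>carr M. act M a m = 0)"

definition locally_finite :: "('x, 'k::field, 'm::ab_group_add) gmod \<Rightarrow> bool"
  where "locally_finite M \<longleftrightarrow>
    (\<forall>j. \<exists>B. finite B \<and> B \<subseteq> piece M j \<and>
      (\<forall>m\<in>piece M j. \<exists>c. m = (\<Sum>b\<in>B. act M (scalar (c b)) b)))"

text \<open>Homogeneous homomorphisms of internal degree \<open>d\<close>. The maps are relevant only on the
  carrier of the source.\<close>

definition ghom :: "('x, 'k::field, 'm::ab_group_add) gmod \<Rightarrow> ('x, 'k, 'n::ab_group_add) gmod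
    \<Rightarrow> int \<Rightarrow> ('m \<Rightarrow> 'n) \<Rightarrow> bool"
  where "ghom M N d f \<longleftrightarrow>
    (\<forall>m\<in>carr M. \<forall>m'\<in>carr M. f (m + m') = f m + f m') \<and>
    (\<forall>a. \<forall>m\<in>carr M. f (act M a m) = act N a (f m)) \<and>
    (\<forall>j. f ` piece M j \<subseteq> piece N (j + d))"

text \<open>The trivial module, i.e. the field in degree 0, on which \<open>T\<close> acts through the augmentation.\<close>

definition trivial_module :: "('x, 'k::field, 'k) gmod"
  where "trivial_module =
    \<lparr> piece = (\<lambda>j. if j = 0 then UNIV else {0}), act = (\<lambda>a c. Poly_Mapping.lookup a [] * c) \<rparr>"


section \<open>Projective resolutions of the trivial module\<close>

text \<open>Projective objects of the category of locally finite graded modules (with the homomorphisms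
  of degree 0). The test modules live on the same type as \<open>P\<close>; see the remark at \<open>K2\<close> below.\<close>

definition projective ::
  "('x, 'k::field) free_alg set \<Rightarrow> ('x, 'k, 'm::ab_group_add) gmod \<Rightarrow> bool"
  where "projective I P \<longleftrightarrow>
    graded_module I P \<and> locally_finite P \<and>
    (\<forall>(M :: ('x, 'k, 'm) gmod) (N :: ('x, 'k, 'm) gmod) g f.
      graded_module I M \<and> locally_finite M \<and> graded_module I N \<and> locally_finite N \<and>
      ghom M N 0 g \<and> g ` carr M = carr N \<and> ghom P N 0 f \<longrightarrow>
      (\<exists>h. ghom P M 0 h \<and> (\<forall>p\<in>carr P. g (h p) = f p)))"

text \<open>The differential \<open>d n\<close> maps \<open>P (Suc n)\<close> to \<open>P n\<close>, and \<open>\<epsilon>\<close> is the augmentation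
  from \<open>P 0\<close> to the trivial module.\<close>

definition projective_resolution :: "('x, 'k::field) free_alg set
    \<Rightarrow> (nat \<Rightarrow> ('x, 'k, 'm::ab_group_add) gmod) \<Rightarrow> (nat \<Rightarrow> 'm \<Rightarrow> 'm) \<Rightarrow> ('m \<Rightarrow> 'k) \<Rightarrow> bool"
  where "projective_resolution I P d \<epsilon> \<longleftrightarrow>
    (\<forall>n. projective I (P n)) \<and>
    (\<forall>n. ghom (P (Suc n)) (P n) 0 (d n)) \<and>
    ghom (P 0) trivial_module 0 \<epsilon> \<and>
    \<epsilon> ` carr (P 0) = UNIV \<and>
    {p \<in> carr (P 0). \<epsilon> p = 0} = d 0 ` carr (P (Suc 0)) \<and>
    (\<forall>n. {p \<in> carr (P (Suc n)). d n p = 0} = d (Suc n) ` carr (P (Suc (Suc n))))"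


section \<open>The bigraded Yoneda algebra\<close>

text \<open>\<open>E\<^sup>n\<^sup>,\<^sup>m(A)\<close>, the \<open>n\<close>-th Ext group in internal degree \<open>-m\<close>, is the quotient of the cocycles by the
  coboundaries of bidegree \<open>(n, m)\<close>: the cohomology at \<open>n\<close> of the complex of homomorphisms of
  internal degree \<open>-m\<close> from the resolution to the trivial module.\<close>

definition ext_cocycle :: "(nat \<Rightarrow> ('x, 'k::field, 'm::ab_group_add) gmod) \<Rightarrow> (nat \<Rightarrow> 'm \<Rightarrow> 'm)
    \<Rightarrow> nat \<Rightarrow> int \<Rightarrow> ('m \<Rightarrow> 'k) \<Rightarrow> bool"
  where "ext_cocycle P d n m f \<longleftrightarrow>
    ghom (P n) trivial_module (- m) f \<and> (\<forall>p\<in>carr (P (Suc n)). f (d n p) = 0)"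

definition ext_coboundary :: "(nat \<Rightarrow> ('x, 'k::field, 'm::ab_group_add) gmod) \<Rightarrow> (nat \<Rightarrow> 'm \<Rightarrow> 'm)
    \<Rightarrow> nat \<Rightarrow> int \<Rightarrow> ('m \<Rightarrow> 'k) \<Rightarrow> bool"
  where "ext_coboundary P d n m f \<longleftrightarrow>
    (case n of
      0 \<Rightarrow> \<forall>p\<in>carr (P 0). f p = 0
    | Suc k \<Rightarrow> \<exists>g. ghom (P k) trivial_module (- m) g \<and> (\<forall>p\<in>carr (P (Suc k)). f p = g (d k p)))"

text \<open>A lift of a cocycle \<open>f\<close> of bidegree \<open>(n, m)\<close> is a chain map \<open>F\<close> from the resolution shifted by \<open>n\<close>
  to the resolution with \<open>\<epsilon> \<circ> F 0 = f\<close>. The Yoneda product of (the class of) a cocycle \<open>g\<close> of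
  cohomological degree \<open>n'\<close> with \<open>f\<close> is represented by \<open>g \<circ> F n'\<close>. Other sign conventions for the
  shift change this product by a sign only, which does not affect generated subalgebras.\<close>

definition yoneda_lift :: "(nat \<Rightarrow> ('x, 'k::field, 'm::ab_group_add) gmod) \<Rightarrow> (nat \<Rightarrow> 'm \<Rightarrow> 'm)
    \<Rightarrow> ('m \<Rightarrow> 'k) \<Rightarrow> nat \<Rightarrow> int \<Rightarrow> ('m \<Rightarrow> 'k) \<Rightarrow> (nat \<Rightarrow> 'm \<Rightarrow> 'm) \<Rightarrow> bool"
  where "yoneda_lift P d \<epsilon> n m f F \<longleftrightarrow>
    (\<forall>i. ghom (P (n + i)) (P i) (- m) (F i)) \<and>
    (\<forall>p\<in>carr (P n). \<epsilon> (F 0 p) = f p) \<and>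
    (\<forall>i. \<forall>p\<in>carr (P (n + Suc i)). d i (F (Suc i) p) = F i (d (n + i) p))"

text \<open>\<open>yoneda_generated P d \<epsilon> D n m f\<close>: the class of \<open>f\<close> in \<open>E\<^sup>n\<^sup>,\<^sup>m(A)\<close> lies in the (unital) subalgebra
  generated by all \<open>E\<^sup>i(A)\<close> with \<open>i \<in> D\<close>. The generating subspaces are bigraded, so the subalgebra is
  the direct sum of its bihomogeneous parts, which are described here. The unit is the class
  of \<open>\<epsilon>\<close>.\<close>

inductive yoneda_generated :: "(nat \<Rightarrow> ('x, 'k::field, 'm::ab_group_add) gmod)
    \<Rightarrow> (nat \<Rightarrow> 'm \<Rightarrow> 'm) \<Rightarrow> ('m \<Rightarrow> 'k) \<Rightarrow> nat set \<Rightarrow> nat \<Rightarrow> int \<Rightarrow> ('m \<Rightarrow> 'k) \<Rightarrow> bool"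
  for P d \<epsilon> D
  where
    unit: "yoneda_generated P d \<epsilon> D 0 0 \<epsilon>"
  | gen: "n \<in> D \<Longrightarrow> ext_cocycle P d n m f \<Longrightarrow> yoneda_generated P d \<epsilon> D n m f"
  | zero: "yoneda_generated P d \<epsilon> D n m (\<lambda>p. 0)"
  | add: "yoneda_generated P d \<epsilon> D n m f \<Longrightarrow> yoneda_generated P d \<epsilon> D n m g
      \<Longrightarrow> yoneda_generated P d \<epsilon> D n m (\<lambda>p. f p + g p)"
  | scale: "yoneda_generated P d \<epsilon> D n m f \<Longrightarrow> yoneda_generated P d \<epsilon> D n m (\<lambda>p. c * f p)"
  | prod: "yoneda_generated P d \<epsilon> D n m f \<Longrightarrow> yoneda_generated P d \<epsilon> D n' m' g
      \<Longrightarrow> yoneda_lift P d \<epsilon> n m f F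
      \<Longrightarrow> yoneda_generated P d \<epsilon> D (n + n') (m + m') (\<lambda>p. g (F n' p))"
  | cohomologous: "yoneda_generated P d \<epsilon> D n m f \<Longrightarrow> ext_cocycle P d n m g
      \<Longrightarrow> ext_coboundary P d n m (\<lambda>p. g p - f p) \<Longrightarrow> yoneda_generated P d \<epsilon> D n m g"

text \<open>The algebra \<open>T / I\<close> is \<open>K\<^sub>2\<close> if its Yoneda algebra, computed from an arbitrary projective
  resolution, is generated by its parts of cohomological degree 1 and 2.

  Carrier type: with finitely many letters, a locally finite graded module has countable dimension,
  hence it is isomorphic to one whose carrier is a subspace of \<^typ>\<open>nat \<Rightarrow>\<^sub>0 'k\<close>. So restricting to
  modules carried by this type loses nothing, neither for the resolutions nor for the test modules
  in the definition of projectivity. In particular such a resolution exists, so that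
  the quantifier below is not vacuous, and since any two are homotopy equivalent, the choice does
  not matter.\<close>

definition K2 :: "('x::finite, 'k::field) free_alg set \<Rightarrow> bool"
  where "K2 I \<longleftrightarrow>
    (\<forall>(P :: nat \<Rightarrow> ('x, 'k, nat \<Rightarrow>\<^sub>0 'k) gmod) d \<epsilon>. projective_resolution I P d \<epsilon> \<longrightarrow>
      (\<forall>n m f. ext_cocycle P d n m f \<longrightarrow> yoneda_generated P d \<epsilon> {1, 2} n m f))"


section \<open>Monomial algebras\<close>

text \<open>Monic monomials of the free algebra are represented by words; a set \<open>R\<close> of words stands for the
  set \<open>mon ` R\<close> of monomials. The image of a monomial in \<open>T / I\<close> is zero iff it lies in \<open>I\<close>.\<close>

definition minimal_generators ::
  "('x, 'k::field) free_alg set \<Rightarrow> ('x, 'k) free_alg set \<Rightarrow> bool"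
  where "minimal_generators I G \<longleftrightarrow> ideal_gen G = I \<and> (\<forall>G'. G' \<subset> G \<longrightarrow> ideal_gen G' \<noteq> I)"

definition LE :: "'x list set \<Rightarrow> 'x list set"
  where "LE R = {a. \<exists>b. length b > 0 \<and> a @ b \<in> R}"

text \<open>The shortest right end \<open>a'\<close> of \<open>a\<close> such that \<open>a'b\<close> vanishes in \<open>T / I\<close>, as an element of \<open>T\<close>.\<close>

definition L :: "('x, 'k::field) free_alg set \<Rightarrow> 'x list \<Rightarrow> 'x list \<Rightarrow> ('x, 'k) free_alg"
  where "L I a b =
    (if mon (a @ b) \<in> I
     then mon (ARG_MIN length a'. suffix a' a \<and> mon (a' @ b) \<in> I)
     else 0)"

inductive_set S :: "('x, 'k::field) free_alg set \<Rightarrow> 'x list set \<Rightarrow> 'x list set"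
  for I R
  where
    var: "[x] \<in> S I R"
  | step: "b \<in> S I R \<Longrightarrow> a \<in> LE R \<Longrightarrow> L I a b = mon a \<Longrightarrow> a \<in> S I R"

end

theory Submission
  imports Defs "HOL-Library.Countable"
begin

text \<open>The trivial module over a monomial algebra \<open>A\<close> has an explicit minimal resolution. If \<open>z\<close> is a monomial
that is nonzero in \<open>A\<close>, then the left annihilator of \<open>z\<close> is spanned by the monomials \<open>w\<close> with
\<open>w z = 0\<close>, and every such \<open>w\<close> has exactly one right end \<open>y\<close> that annihilates \<open>z\<close> minimally. So the
annihilator is the direct sum of the left ideals \<open>A y\<close>, and the annihilator of each \<open>y\<close> is of the same
kind again. Call a list \<open>[b\<^sub>n, \<dots>, b\<^sub>1]\<close> a chain if \<open>b\<^sub>1\<close> is a letter and every other entry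
annihilates the next one in the list minimally. The free modules on the chains of length \<open>n\<close>, with the
differential that sends the generator of \<open>y # q\<close> to \<open>y\<close> times the generator of \<open>q\<close>, form a
resolution (\<open>resolution_Q\<close>). Its differential has entries in the augmentation ideal, so the chains of
length \<open>n\<close> index a basis of the \<open>n\<close>-th Ext group: the functionals \<open>dual c\<close>. The set \<open>S\<close> consists of the
first entries of the chains (\<open>in_S_iff\<close>), and the condition of the theorem says that no chain begins
with entries \<open>a, b\<close> such that \<open>a\<close> has length at least 2 and \<open>a b\<close> is not a relation. Such a
chain is called obstructing below.

Everything about products comes from one recursion (\<open>lift_coefficient\<close>). If \<open>F\<close> lifts a cocycle, then
comparing coefficients in the equation between \<open>F\<close> and the differential shows, for \<open>w z\<close> nonzero in
\<open>A\<close>, that the coefficient of \<open>w\<close> times the generator \<open>z # t\<close> in the image of the generator \<open>y # q\<close> equals, if \<open>w z = y v\<close>, the coefficient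
of \<open>v\<close> times the generator \<open>t\<close> in the image of the generator \<open>q\<close>, and that it is 0 if \<open>y\<close> is not a
left end of \<open>w z\<close>.

Necessity: by two steps of the recursion, if the generator of a nonempty chain \<open>p\<close> occurs with a nonzero scalar coefficient in the
image of an obstructing chain that begins with \<open>a, b\<close>, then \<open>p\<close> begins with \<open>y, z\<close> where \<open>y\<close> extends
\<open>a\<close> and \<open>y z = a b u\<close> for some \<open>u\<close>. The relations form an antichain and \<open>a b\<close> contains one of
them, so \<open>y z\<close> is not a relation, and \<open>p\<close> is obstructing as well. Therefore the classes that vanish on all
obstructing chains are closed under products. They include all of degree 1 and 2, because obstructing
chains have length at least 3. The functional dual to an obstructing chain is not among them.

Sufficiency: without obstructing chains, a chain of length at least 3 has the form \<open>a # c\<close> with \<open>a\<close> a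
letter, or \<open>a # b # c\<close> with a relation \<open>a b\<close>. The recursion shows that its dual functional is the
product of the dual of \<open>c\<close> with a class of degree 1 or 2 (\<open>product_with_letter\<close>,
\<open>product_with_relation\<close>). By induction all classes are generated.

The first direction needs this one resolution only. For the second one, the products are carried over
to an arbitrary projective resolution by the comparison theorem
(\<open>chain_map_exists\<close>, \<open>chain_maps_cohomologous\<close>).\<close>

section \<open>Graded modules and their homomorphisms\<close>

abbreviation lookup :: "('a \<Rightarrow>\<^sub>0 'b::zero) \<Rightarrow> 'a \<Rightarrow> 'b"
  where "lookup \<equiv> Poly_Mapping.lookup"

abbreviation keys :: "('a \<Rightarrow>\<^sub>0 'b::zero) \<Rightarrow> 'a set"
  where "keys \<equiv> Poly_Mapping.keys"

abbreviation single :: "'a \<Rightarrow> 'b \<Rightarrow> 'a \<Rightarrow>\<^sub>0 'b::zero"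
  where "single \<equiv> Poly_Mapping.single"

lemma poly_mapping_sum_single: "(\<Sum>w\<in>keys p. single w (lookup p w)) = p"
proof (rule poly_mapping_eqI)
  fix k
  show "lookup (\<Sum>w\<in>keys p. single w (lookup p w)) k = lookup p k"
  proof (cases "k \<in> keys p")
    case True
    then show ?thesis by (simp add: lookup_sum lookup_single when_def)
  next
    case False
    then show ?thesis by (simp add: lookup_sum lookup_single when_def in_keys_iff)
  qed
qed

lemma piece_subset_carr: "m \<in> piece M j \<Longrightarrow> m \<in> carr M"
  unfolding carr_def by (rule CollectI, rule exI[of _ "{j}"], rule exI[of _ "\<lambda>_. m"]) simp

lemma zero_in_carr: "0 \<in> carr M"
  unfolding carr_def by (rule CollectI, rule exI[of _ "{}"]) simp

locale gr_module =
  fixes I :: "('x, 'k::field) free_alg set" and M :: "('x, 'k, 'm::ab_group_add) gmod"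
  assumes graded: "graded_module I M"
begin

lemma piece_zero: "0 \<in> piece M j"
  using graded[unfolded graded_module_def, THEN conjunct1] by simp

lemma piece_add:
  "m \<in> piece M j \<Longrightarrow> m' \<in> piece M j \<Longrightarrow> m + m' \<in> piece M j"
  using graded[unfolded graded_module_def, THEN conjunct1] by simp

lemma piece_indep:
  "finite J \<Longrightarrow> (\<And>j. j \<in> J \<Longrightarrow> c j \<in> piece M j) \<Longrightarrow> (\<Sum>j\<in>J. c j) = 0 \<Longrightarrow> j \<in> J \<Longrightarrow> c j = 0"
  using graded[unfolded graded_module_def, THEN conjunct2, THEN conjunct1] by simp

lemma act_piece:
  "a \<in> homog d \<Longrightarrow> m \<in> piece M j \<Longrightarrow> act M a m \<in> piece M (int d + j)"
  using graded[unfolded graded_module_def, THEN conjunct2, THEN conjunct2, THEN conjunct1] by simp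

lemma act_add_right:
  "m \<in> carr M \<Longrightarrow> m' \<in> carr M \<Longrightarrow> act M a (m + m') = act M a m + act M a m'"
  using graded[unfolded graded_module_def, THEN conjunct2, THEN conjunct2, THEN conjunct2, THEN conjunct1] by simp

lemma act_add_left: "m \<in> carr M \<Longrightarrow> act M (a + b) m = act M a m + act M b m"
  using graded[unfolded graded_module_def, THEN conjunct2, THEN conjunct2, THEN conjunct2, THEN conjunct2, THEN conjunct1] by simp

lemma act_mult: "m \<in> carr M \<Longrightarrow> act M (a * b) m = act M a (act M b m)"
  using graded[unfolded graded_module_def, THEN conjunct2, THEN conjunct2, THEN conjunct2, THEN conjunct2, THEN conjunct2, THEN conjunct1] by simp

lemma act_one: "m \<in> carr M \<Longrightarrow> act M 1 m = m"
  using graded[unfolded graded_module_def, THEN conjunct2, THEN conjunct2, THEN conjunct2, THEN conjunct2, THEN conjunct2, THEN conjunct2, THEN conjunct1] by simp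

lemma act_ideal: "a \<in> I \<Longrightarrow> m \<in> carr M \<Longrightarrow> act M a m = 0"
  using graded[unfolded graded_module_def, THEN conjunct2, THEN conjunct2, THEN conjunct2, THEN conjunct2, THEN conjunct2, THEN conjunct2, THEN conjunct2] by simp

lemma carr_add:
  assumes "m \<in> carr M" "m' \<in> carr M"
  shows "m + m' \<in> carr M"
proof -
  obtain J c where J: "finite J" "\<And>j. j \<in> J \<Longrightarrow> c j \<in> piece M j" "m = (\<Sum>j\<in>J. c j)"
    using assms(1) unfolding carr_def by blast
  obtain J' c' where J': "finite J'" "\<And>j. j \<in> J' \<Longrightarrow> c' j \<in> piece M j" "m' = (\<Sum>j\<in>J'. c' j)"
    using assms(2) unfolding carr_def by blast
  define e where "e j = (if j \<in> J then c j else 0) + (if j \<in> J' then c' j else 0)" for j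
  have 1: "(\<Sum>j\<in>J \<union> J'. if j \<in> J then c j else 0) = m"
    unfolding J(3) using J(1) J'(1) by (intro sum.mono_neutral_cong_right) auto
  have 2: "(\<Sum>j\<in>J \<union> J'. if j \<in> J' then c' j else 0) = m'"
    unfolding J'(3) using J(1) J'(1) by (intro sum.mono_neutral_cong_right) auto
  have sum: "m + m' = (\<Sum>j\<in>J \<union> J'. e j)"
    unfolding e_def sum.distrib 1 2 ..
  have "e j \<in> piece M j" for j
    unfolding e_def using J(2) J'(2) by (auto intro: piece_add piece_zero)
  then have "finite (J \<union> J') \<and> (\<forall>j\<in>J \<union> J'. e j \<in> piece M j) \<and> m + m' = (\<Sum>j\<in>J \<union> J'. e j)"
    using J(1) J'(1) sum by simp
  then show ?thesis
    unfolding carr_def mem_Collect_eq by (intro exI)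
qed

lemma carr_sum:
  "(\<And>j. j \<in> J \<Longrightarrow> c j \<in> carr M) \<Longrightarrow> (\<Sum>j\<in>J. c j) \<in> carr M"
  by (induction J rule: infinite_finite_induct) (auto intro: carr_add zero_in_carr)

lemma piece_sum:
  "(\<And>i. i \<in> J \<Longrightarrow> c i \<in> piece M j) \<Longrightarrow> (\<Sum>i\<in>J. c i) \<in> piece M j"
  by (induction J rule: infinite_finite_induct) (auto intro: piece_add piece_zero)

lemma act_zero_left: "m \<in> carr M \<Longrightarrow> act M 0 m = 0"
  using act_add_left[of m 0 0] by simp

lemma act_zero_right: "act M a 0 = 0"
  using act_add_right[of 0 0 a] by (simp add: zero_in_carr)

lemma act_sum_left:
  "m \<in> carr M \<Longrightarrow> act M (\<Sum>j\<in>J. c j) m = (\<Sum>j\<in>J. act M (c j) m)"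
  by (induction J rule: infinite_finite_induct) (auto simp: act_zero_left act_add_left)

lemma act_sum_right:
  "(\<And>j. j \<in> J \<Longrightarrow> c j \<in> carr M) \<Longrightarrow> act M a (\<Sum>j\<in>J. c j) = (\<Sum>j\<in>J. act M a (c j))"
  by (induction J rule: infinite_finite_induct) (auto simp: act_zero_right act_add_right carr_sum)

lemma act_carr:
  assumes "m \<in> carr M"
  shows "act M a m \<in> carr M"
proof -
  obtain J c where J: "finite J" "\<And>j. j \<in> J \<Longrightarrow> c j \<in> piece M j" "m = (\<Sum>j\<in>J. c j)"
    using assms unfolding carr_def by blast
  have "act M (single w x) (c j) \<in> carr M" if "j \<in> J" for w x j
    by (rule piece_subset_carr, rule act_piece[of _ "length w"])
      (use that J(2) in \<open>auto simp: homog_def\<close>)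
  then have "act M (single w x) m \<in> carr M" for w x
    unfolding J(3) by (subst act_sum_right) (use J(2) piece_subset_carr in \<open>blast intro: carr_sum\<close>)+
  then have "act M (\<Sum>w\<in>keys a. single w (lookup a w)) m \<in> carr M"
    using assms by (auto simp: act_sum_left intro!: carr_sum)
  then show ?thesis
    by (simp add: poly_mapping_sum_single)
qed

lemma act_minus_one: "m \<in> carr M \<Longrightarrow> act M (- 1) m = - m"
  using act_add_left[of m 1 "- 1"] by (simp add: act_zero_left act_one eq_neg_iff_add_eq_0 add.commute)

lemma carr_uminus: "m \<in> carr M \<Longrightarrow> - m \<in> carr M"
  using act_carr[of m "- 1"] by (simp add: act_minus_one)

lemma carr_diff:
  "m \<in> carr M \<Longrightarrow> m' \<in> carr M \<Longrightarrow> m - m' \<in> carr M"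
  using carr_add[of m "- m'"] by (simp add: carr_uminus)

lemma act_uminus: "m \<in> carr M \<Longrightarrow> act M a (- m) = - act M a m"
  using act_add_right[of m "- m" a]
  by (simp add: carr_uminus act_zero_right eq_neg_iff_add_eq_0 add.commute)

lemma act_diff:
  "m \<in> carr M \<Longrightarrow> m' \<in> carr M \<Longrightarrow> act M a (m - m') = act M a m - act M a m'"
  using act_add_right[of m "- m'" a] by (simp add: carr_uminus act_uminus)

lemma piece_uminus: "m \<in> piece M j \<Longrightarrow> - m \<in> piece M j"
  using act_piece[of "- 1" 0 m j] act_minus_one[of m]
  by (auto simp: homog_def piece_subset_carr in_keys_iff zero_list_def lookup_one when_def split: if_splits)

lemma piece_diff:
  "m \<in> piece M j \<Longrightarrow> m' \<in> piece M j \<Longrightarrow> m - m' \<in> piece M j"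
  using piece_add[of m j "- m'"] by (simp add: piece_uminus)

text \<open>Homogeneous components are unique: the independence axiom applies to the family from which the homogeneous
element itself is subtracted in degree \<open>j\<close>.\<close>

lemma component_unique:
  assumes "finite J" "\<And>i. i \<in> J \<Longrightarrow> c i \<in> piece M i" "(\<Sum>i\<in>J. c i) \<in> piece M j"
  shows "(\<Sum>i\<in>J. c i) = (if j \<in> J then c j else 0)"
proof -
  let ?m = "\<Sum>i\<in>J. c i"
  define e where "e i = (if i \<in> J then c i else 0) - (if i = j then ?m else 0)" for i
  have 1: "(\<Sum>i\<in>insert j J. if i \<in> J then c i else 0) = ?m"
    using assms(1) by (intro sum.mono_neutral_cong_right) auto
  have "(\<Sum>i\<in>insert j J. e i) = ?m - (\<Sum>i\<in>insert j J. if i = j then ?m else 0)"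
    unfolding e_def sum_subtractf 1 ..
  also have "\<dots> = 0"
    using assms(1) by (subst sum.delta) auto
  finally have "e j = 0"
    by (intro piece_indep[of "insert j J" e j])
      (use assms in \<open>auto simp: e_def intro: piece_diff piece_zero piece_uminus\<close>)
  then show ?thesis
    by (simp add: e_def split: if_splits)
qed

end

lemma gr_moduleI:
  assumes "\<And>j. 0 \<in> piece M j"
    and "\<And>j m m'. m \<in> piece M j \<Longrightarrow> m' \<in> piece M j \<Longrightarrow> m + m' \<in> piece M j"
    and "\<And>J c j. finite J \<Longrightarrow> \<forall>j\<in>J. c j \<in> piece M j \<Longrightarrow> (\<Sum>j\<in>J. c j) = 0 \<Longrightarrow> j \<in> J \<Longrightarrow> c j = 0"
    and "\<And>d a j m. a \<in> homog d \<Longrightarrow> m \<in> piece M j \<Longrightarrow> act M a m \<in> piece M (int d + j)"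
    and "\<And>a m m'. m \<in> carr M \<Longrightarrow> m' \<in> carr M \<Longrightarrow> act M a (m + m') = act M a m + act M a m'"
    and "\<And>a b m. m \<in> carr M \<Longrightarrow> act M (a + b) m = act M a m + act M b m"
    and "\<And>a b m. m \<in> carr M \<Longrightarrow> act M (a * b) m = act M a (act M b m)"
    and "\<And>m. m \<in> carr M \<Longrightarrow> act M 1 m = m"
    and "\<And>a m. a \<in> I \<Longrightarrow> m \<in> carr M \<Longrightarrow> act M a m = 0"
  shows "gr_module I M"
  unfolding gr_module_def graded_module_def
  by (intro conjI allI ballI impI; (rule assms; assumption))

lemma ghom_add:
  "ghom M N d f \<Longrightarrow> m \<in> carr M \<Longrightarrow> m' \<in> carr M \<Longrightarrow> f (m + m') = f m + f m'"
  and ghom_act: "ghom M N d f \<Longrightarrow> m \<in> carr M \<Longrightarrow> f (act M a m) = act N a (f m)"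
  and ghom_piece: "ghom M N d f \<Longrightarrow> m \<in> piece M j \<Longrightarrow> f m \<in> piece N (j + d)"
  unfolding ghom_def by blast+

lemma ghom_zero: "ghom M N d f \<Longrightarrow> f 0 = 0"
  using ghom_add[of M N d f 0 0] by (simp add: zero_in_carr)

locale gr_hom = source: gr_module I M + target: gr_module I N
  for I :: "('x, 'k::field) free_alg set"
    and M :: "('x, 'k, 'm::ab_group_add) gmod" and N :: "('x, 'k, 'n::ab_group_add) gmod" +
  fixes d f
  assumes hom: "ghom M N d f"
begin

lemma sum:
  "(\<And>j. j \<in> J \<Longrightarrow> c j \<in> carr M) \<Longrightarrow> f (\<Sum>j\<in>J. c j) = (\<Sum>j\<in>J. f (c j))"
  by (induction J rule: infinite_finite_induct)
    (auto simp: ghom_zero[OF hom] ghom_add[OF hom] source.carr_sum)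

lemma carr: "m \<in> carr M \<Longrightarrow> f m \<in> carr N"
proof -
  assume "m \<in> carr M"
  then obtain J c where J: "finite J" "\<And>j. j \<in> J \<Longrightarrow> c j \<in> piece M j" "m = (\<Sum>j\<in>J. c j)"
    unfolding carr_def by blast
  have "f m = (\<Sum>j\<in>J. f (c j))"
    unfolding J(3) using J(2) by (intro sum) (auto intro: piece_subset_carr)
  then show "f m \<in> carr N"
    using J(2) hom by (auto intro!: target.carr_sum intro: piece_subset_carr ghom_piece)
qed

lemma uminus: "m \<in> carr M \<Longrightarrow> f (- m) = - f m"
  using ghom_add[OF hom, of m "- m"]
  by (simp add: source.carr_uminus ghom_zero[OF hom] eq_neg_iff_add_eq_0 add.commute)

lemma diff:
  "m \<in> carr M \<Longrightarrow> m' \<in> carr M \<Longrightarrow> f (m - m') = f m - f m'"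
  using ghom_add[OF hom, of m "- m'"] by (simp add: source.carr_uminus uminus)

end

lemma ghom_compose:
  assumes "gr_module I M" "gr_module I N" "ghom M N d f" "ghom N N' e g"
  shows "ghom M N' (d + e) (\<lambda>m. g (f m))"
proof -
  interpret gr_hom I M N d f
    using assms by (simp add: gr_hom_def gr_hom_axioms_def)
  show ?thesis
    unfolding ghom_def
    using carr ghom_piece[OF hom] ghom_piece[OF assms(4)]
    by (force simp: ghom_add[OF hom] ghom_act[OF hom] ghom_add[OF assms(4)] ghom_act[OF assms(4)] add.assoc)
qed

lemma ghom_diff:
  assumes "gr_module I M" "gr_module I N" "ghom M N d f" "ghom M N d g"
  shows "ghom M N d (\<lambda>m. f m - g m)"
proof -
  interpret f: gr_hom I M N d f
    using assms by (simp add: gr_hom_def gr_hom_axioms_def)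
  interpret g: gr_hom I M N d g
    using assms by (simp add: gr_hom_def gr_hom_axioms_def)
  show ?thesis
    unfolding ghom_def
    by (auto simp: ghom_add[OF f.hom] ghom_act[OF f.hom] ghom_add[OF g.hom] ghom_act[OF g.hom]
      f.target.act_diff f.carr g.carr
      intro!: f.target.piece_diff ghom_piece[OF f.hom] ghom_piece[OF g.hom])
qed

text \<open>Surjectivity in \<open>projective\<close> is a statement about whole modules. This lemma turns it into
surjectivity on homogeneous pieces.\<close>

lemma (in gr_hom) homogeneous_preimage:
  assumes "d = 0" "m \<in> carr M" "f m \<in> piece N j"
  obtains m' where "m' \<in> piece M j" "f m' = f m"
proof -
  obtain J c where J: "finite J" "\<And>j. j \<in> J \<Longrightarrow> c j \<in> piece M j" "m = (\<Sum>j\<in>J. c j)"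
    using assms(2) unfolding carr_def by blast
  have eq: "f m = (\<Sum>j\<in>J. f (c j))"
    unfolding J(3) using J(2) by (intro sum) (auto intro: piece_subset_carr)
  have "f (c i) \<in> piece N i" if "i \<in> J" for i
    using ghom_piece[OF hom J(2)[OF that]] assms(1) by simp
  then have "f m = (if j \<in> J then f (c j) else 0)"
    using target.component_unique[of J "\<lambda>i. f (c i)" j] J(1) assms(3) eq by auto
  then show ?thesis
    using that[of "if j \<in> J then c j else 0"] J(2) source.piece_zero ghom_zero[OF hom]
    by (auto split: if_splits)
qed

lemma act_trivial_module: "act trivial_module a c = lookup a [] * c"
  and piece_trivial_module: "piece trivial_module j = (if j = 0 then UNIV else {0})"
  by (simp_all add: trivial_module_def)

lemma lookup_mult_Nil:
  fixes a b :: "('x, 'k::field) free_alg"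
  shows "lookup (a * b) [] = lookup a [] * lookup b []"
proof -
  have *: "([] = l + q) = (l = [] \<and> q = [])" for l q :: "'x list"
    by (auto simp: plus_list_def)
  have "lookup (a * b) [] = (\<Sum>l. (lookup a l * (\<Sum>q. (lookup b q when q = []))) when l = [])"
    unfolding lookup_mult * by (intro Sum_any.cong) (auto simp: when_def)
  then show ?thesis by simp
qed

lemma graded_trivial_module:
  fixes I :: "('x, 'k::field) free_alg set"
  assumes "\<And>a. a \<in> I \<Longrightarrow> lookup a [] = 0"
  shows "gr_module I (trivial_module :: ('x, 'k, 'k) gmod)"
proof -
  have one: "lookup (1 :: ('x, 'k) free_alg) [] = 1"
    by (simp add: lookup_one zero_list_def)
  have "\<forall>j\<in>J. c j = 0" if "finite J" "\<forall>j\<in>J. c j \<in> (if j = (0::int) then UNIV else {0::'k})" "(\<Sum>j\<in>J. c j) = 0" for J c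
  proof -
    have "(\<Sum>j\<in>J. c j) = (\<Sum>j\<in>J. if j = 0 then c j else 0)"
      using that by (intro sum.cong) (auto split: if_splits)
    then show ?thesis
      using that by (auto simp: sum.delta split: if_splits)
  qed
  note indep = this
  have deg: "lookup a [] = 0" if "a \<in> homog d" "d > 0" for a :: "('x, 'k) free_alg" and d
  proof (rule ccontr)
    assume "lookup a [] \<noteq> 0"
    then have "[] \<in> keys a" by (simp add: in_keys_iff)
    then show False using that by (auto simp: homog_def)
  qed
  show ?thesis
  proof ((rule gr_moduleI; (unfold act_trivial_module piece_trivial_module)?), goal_cases)
    case (3 J c j)
    then show ?case using indep[of J c] by blast
  next
    case (4 d a j m)
    then show ?case using deg[of a d] by (cases "d = 0") (auto split: if_splits)
  qed (auto simp: assms one lookup_mult_Nil lookup_add distrib_left distrib_right split: if_splits)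
qed


section \<open>Comparison of projective resolutions\<close>

text \<open>Cocycles and their lifts may have any internal degree, whereas \<open>projective\<close> speaks of degree 0. Shifting
the gradings of the test modules reduces the former to the latter.\<close>

lemma shift_module:
  fixes M :: "('x, 'k::field, 'm::ab_group_add) gmod" and k :: int
  assumes "gr_module I M"
  defines "M' \<equiv> \<lparr>piece = (\<lambda>j. piece M (j + k)), act = act M\<rparr>"
  shows "gr_module I M'" and "carr M' = carr M"
proof -
  interpret gr_module I M by fact
  show carr: "carr M' = carr M"
  proof (intro set_eqI iffI)
    fix m assume "m \<in> carr M'"
    then obtain J c where J: "finite J" "\<And>j. j \<in> J \<Longrightarrow> c j \<in> piece M (j + k)" "m = (\<Sum>j\<in>J. c j)"
      unfolding carr_def M'_def by auto
    then show "m \<in> carr M"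
      by (auto intro!: carr_sum intro: piece_subset_carr)
  next
    fix m assume "m \<in> carr M"
    then obtain J c where J: "finite J" "\<And>j. j \<in> J \<Longrightarrow> c j \<in> piece M j" "m = (\<Sum>j\<in>J. c j)"
      unfolding carr_def by blast
    have "m = (\<Sum>j\<in>(\<lambda>j. j - k) ` J. c (j + k))"
      unfolding J(3) by (subst sum.reindex) (auto simp: inj_on_def)
    then show "m \<in> carr M'"
      unfolding carr_def M'_def
      by (intro CollectI exI[of _ "(\<lambda>j. j - k) ` J"] exI[of _ "\<lambda>j. c (j + k)"]) (use J in auto)
  qed
  show "gr_module I M'"
  proof -
    have "c j = 0" if "finite J" "\<forall>j\<in>J. c j \<in> piece M (j + k)" "(\<Sum>j\<in>J. c j) = 0" "j \<in> J" for J c j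
    proof -
      have "(\<Sum>j\<in>(\<lambda>j. j + k) ` J. c (j - k)) = 0"
        using that(3) by (subst sum.reindex) (auto simp: inj_on_def)
      from piece_indep[of "(\<lambda>j. j + k) ` J" "\<lambda>j. c (j - k)" "j + k", OF _ _ this]
      have "c ((j + k) - k) = 0"
        using that by force
      then show ?thesis by simp
    qed
    note indep = this
    show "gr_module I M'"
    proof ((rule gr_moduleI; (unfold carr)?), goal_cases)
      case (3 J c j)
      then show ?case using indep[of J c j] by (simp add: M'_def)
    next
      case (4 d a j m)
      then show ?case using act_piece[of a d m "j + k"] by (simp add: M'_def add.assoc)
    qed (auto simp: M'_def piece_zero piece_add act_add_right act_add_left act_mult act_one act_ideal)
  qed
qed

text \<open>The test modules of \<open>projective\<close> all live on one type, and they have to be locally finite. A map into any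
module can be replaced by the map onto its image, carried along an additive injection \<open>\<iota>\<close> to the
right type. Local finiteness of the image is inherited from the source; for a kernel it would require
linear algebra.\<close>

lemma image_module:
  fixes M :: "('x, 'k::field, 'm::ab_group_add) gmod" and N :: "('x, 'k, 'n::ab_group_add) gmod"
    and \<iota> :: "'n \<Rightarrow> 'l::ab_group_add"
  assumes "gr_module I M" "locally_finite M" "gr_module I N" "ghom M N 0 g"
    and "inj \<iota>" "\<And>y z. \<iota> (y + z) = \<iota> y + \<iota> z"
  defines "N' \<equiv> \<lparr>piece = (\<lambda>j. \<iota> ` g ` piece M j), act = (\<lambda>a y. \<iota> (act N a (inv \<iota> y)))\<rparr>"
  shows "gr_module I N'" and "locally_finite N'" and "carr N' = \<iota> ` g ` carr M"
    and "ghom M N' 0 (\<lambda>m. \<iota> (g m))"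
proof -
  interpret gr_hom I M N 0 g
    using assms by (simp add: gr_hom_def gr_hom_axioms_def)
  have \<iota>0: "\<iota> 0 = 0"
    using assms(6)[of 0 0] by simp
  have \<iota>_sum: "\<iota> (\<Sum>j\<in>J. c j) = (\<Sum>j\<in>J. \<iota> (c j))" for J :: "'i set" and c
    by (induction J rule: infinite_finite_induct) (auto simp: \<iota>0 assms(6))
  have inv_\<iota>: "inv \<iota> (\<iota> y) = y" for y
    using assms(5) by simp
  have \<iota>_eq: "\<iota> y = \<iota> z \<longleftrightarrow> y = z" for y z
    using assms(5) by (auto simp: inj_def)
  show carr_N': "carr N' = \<iota> ` g ` carr M"
  proof (intro set_eqI iffI)
    fix y assume "y \<in> carr N'"
    then obtain J c where J: "finite J" "\<forall>j\<in>J. c j \<in> \<iota> ` g ` piece M j" "y = (\<Sum>j\<in>J. c j)"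
      unfolding carr_def N'_def by auto
    from J(2) have "\<forall>j\<in>J. \<exists>m. m \<in> piece M j \<and> c j = \<iota> (g m)" by auto
    then obtain m where m: "\<And>j. j \<in> J \<Longrightarrow> m j \<in> piece M j \<and> c j = \<iota> (g (m j))" by metis
    have mc: "\<And>j. j \<in> J \<Longrightarrow> m j \<in> carr M"
      using m piece_subset_carr by blast
    have "y = \<iota> (g (\<Sum>j\<in>J. m j))"
      using m J(3) mc by (simp add: sum \<iota>_sum)
    then show "y \<in> \<iota> ` g ` carr M"
      using source.carr_sum[of J m] mc by blast
  next
    fix y assume "y \<in> \<iota> ` g ` carr M"
    then obtain m where m: "m \<in> carr M" "y = \<iota> (g m)" by auto
    then obtain J c where J: "finite J" "\<And>j. j \<in> J \<Longrightarrow> c j \<in> piece M j" "m = (\<Sum>j\<in>J. c j)"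
      unfolding carr_def by blast
    have "y = (\<Sum>j\<in>J. \<iota> (g (c j)))"
      unfolding m(2) J(3) using J(2) by (subst sum) (auto intro: piece_subset_carr simp: \<iota>_sum)
    then show "y \<in> carr N'"
      unfolding carr_def N'_def
      by (intro CollectI exI[of _ J] exI[of _ "\<lambda>j. \<iota> (g (c j))"]) (use J in auto)
  qed
  have in_N: "g m \<in> carr N" if "m \<in> carr M" for m
    using that by (rule carr)
  show "gr_module I N'"
  proof -
    have indep: "c j = 0" if J: "finite J" "\<forall>j\<in>J. c j \<in> \<iota> ` g ` piece M j" "(\<Sum>j\<in>J. c j) = 0" "j \<in> J" for J c j
    proof -
      from J(2) have "\<forall>j\<in>J. \<exists>m. m \<in> piece M j \<and> c j = \<iota> (g m)" by auto
      then obtain m where m: "\<And>j. j \<in> J \<Longrightarrow> m j \<in> piece M j \<and> c j = \<iota> (g (m j))" by metis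
      have "\<iota> (\<Sum>j\<in>J. g (m j)) = \<iota> 0"
        using m J(3) by (simp add: \<iota>_sum \<iota>0)
      then have "(\<Sum>j\<in>J. g (m j)) = 0"
        by (simp only: \<iota>_eq)
      moreover have "g (m j) \<in> piece N j" if "j \<in> J" for j
        using ghom_piece[OF hom, of "m j" j] m that by simp
      ultimately have "g (m j) = 0"
        using target.piece_indep[of J "\<lambda>j. g (m j)" j] J by auto
      then show ?thesis
        using m J(4) \<iota>0 by simp
    qed
    have add: "y + z \<in> \<iota> ` g ` piece M j" if "y \<in> \<iota> ` g ` piece M j" "z \<in> \<iota> ` g ` piece M j" for y z j
    proof -
      obtain m m' where m: "m \<in> piece M j" "y = \<iota> (g m)" "m' \<in> piece M j" "z = \<iota> (g m')"
        using \<open>y \<in> _\<close> \<open>z \<in> _\<close> by auto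
      then have "y + z = \<iota> (g (m + m'))"
        by (simp add: ghom_add[OF hom] piece_subset_carr[of _ M j] assms(6))
      then show ?thesis
        using source.piece_add m by blast
    qed
    have zero: "0 \<in> \<iota> ` g ` piece M j" for j
      using source.piece_zero[of j] ghom_zero[OF hom] \<iota>0 by (metis imageI)
    have act: "\<iota> (act N a (g m)) \<in> \<iota> ` g ` piece M (int e + j)" if "a \<in> homog e" "m \<in> piece M j" for a e m j
      using that ghom_act[OF hom, of m a, symmetric] source.act_piece[OF that]
      by (auto simp: piece_subset_carr)
    have add_right: "\<iota> (act N a (inv \<iota> (\<iota> (g m) + \<iota> (g m')))) = \<iota> (act N a (g m)) + \<iota> (act N a (g m'))"
      if "m \<in> carr M" "m' \<in> carr M" for a m m'
      using that in_N by (simp add: inv_\<iota> target.act_add_right flip: assms(6))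
    show "gr_module I N'"
    proof ((rule gr_moduleI; (unfold carr_N')?), goal_cases)
      case (1 j)
      show ?case using zero by (simp add: N'_def)
    next
      case (2 j m m')
      then show ?case using add by (simp add: N'_def)
    next
      case (3 J c j)
      then show ?case using indep[of J c j] by (simp add: N'_def)
    next
      case (4 d a j m)
      then show ?case using act by (auto simp: N'_def inv_\<iota>)
    next
      case (5 a m m')
      then show ?case using add_right by (auto simp: N'_def inv_\<iota>)
    qed (auto simp: N'_def inv_\<iota> in_N target.act_add_left target.act_mult
          target.act_one target.act_ideal target.act_carr assms(6) \<iota>0)
  qed
  show "ghom M N' 0 (\<lambda>m. \<iota> (g m))"
    unfolding ghom_def N'_def by (auto simp: ghom_add[OF hom] ghom_act[OF hom] assms(6) inv_\<iota>)
  show "locally_finite N'"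
    unfolding locally_finite_def
  proof
    fix j
    obtain B where B: "finite B" "B \<subseteq> piece M j"
      "\<And>m. m \<in> piece M j \<Longrightarrow> \<exists>c. m = (\<Sum>b\<in>B. act M (scalar (c b)) b)"
      using assms(2) unfolding locally_finite_def by meson
    let ?h = "\<lambda>m. \<iota> (g m)"
    have "\<exists>c. y = (\<Sum>b\<in>?h ` B. act N' (scalar (c b)) b)" if "y \<in> piece N' j" for y
    proof -
      obtain m where m: "m \<in> piece M j" "y = ?h m"
        using \<open>y \<in> piece N' j\<close> unfolding N'_def by auto
      obtain c where c: "m = (\<Sum>b\<in>B. act M (scalar (c b)) b)"
        using B(3)[OF m(1)] by auto
      have Bc: "b \<in> carr M" if "b \<in> B" for b
        using B(2) that piece_subset_carr by blast
      have "y = (\<Sum>b\<in>B. ?h (act M (scalar (c b)) b))"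
        unfolding m(2) c by (subst sum) (auto simp: \<iota>_sum Bc intro!: source.act_carr)
      also have "\<dots> = (\<Sum>z\<in>?h ` B. \<Sum>b\<in>{b\<in>B. ?h b = z}. ?h (act M (scalar (c b)) b))"
        by (rule sum.image_gen[OF B(1)])
      also have "\<dots> = (\<Sum>z\<in>?h ` B. act N' (scalar (\<Sum>b\<in>{b\<in>B. ?h b = z}. c b)) z)"
      proof (rule sum.cong[OF refl])
        fix z assume "z \<in> ?h ` B"
        then obtain b0 where b0: "b0 \<in> B" "z = ?h b0" by auto
        have "(scalar (\<Sum>b\<in>C. c b) :: ('x, 'k) free_alg) = (\<Sum>b\<in>C. scalar (c b))" for C
          by (induction C rule: infinite_finite_induct) (auto simp: scalar_def single_add)
        then have "act N' (scalar (\<Sum>b\<in>{b\<in>B. ?h b = z}. c b)) z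
            = \<iota> (\<Sum>b\<in>{b\<in>B. ?h b = z}. act N (scalar (c b)) (g b0))"
          using b0 in_N Bc by (simp add: N'_def inv_\<iota> target.act_sum_left)
        also have "\<dots> = (\<Sum>b\<in>{b\<in>B. ?h b = z}. ?h (act M (scalar (c b)) b))"
          unfolding \<iota>_sum
          by (rule sum.cong[OF refl]) (use b0 in \<open>auto simp: ghom_act[OF hom] Bc \<iota>_eq\<close>)
        finally show "(\<Sum>b\<in>{b\<in>B. ?h b = z}. ?h (act M (scalar (c b)) b))
            = act N' (scalar (\<Sum>b\<in>{b\<in>B. ?h b = z}. c b)) z" ..
      qed
      finally show ?thesis
        by (intro exI[of _ "\<lambda>z. \<Sum>b\<in>{b\<in>B. ?h b = z}. c b"])
    qed
    then show "\<exists>B. finite B \<and> B \<subseteq> piece N' j \<and> (\<forall>m\<in>piece N' j. \<exists>c. m = (\<Sum>b\<in>B. act N' (scalar (c b)) b))"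
      using B(1,2) by (intro exI[of _ "?h ` B"]) (auto simp: N'_def)
  qed
qed


lemma projective_gr_module: "projective I P \<Longrightarrow> gr_module I P"
  and projective_locally_finite: "projective I P \<Longrightarrow> locally_finite P"
  by (simp_all add: projective_def gr_module_def)

text \<open>The lifting property in the form in which it is used: any internal degree \<open>k\<close>, a target that may live on
another type, and surjectivity replaced by the containment of images.\<close>

lemma projective_lift:
  fixes P M :: "('x, 'k::field, 'm::ab_group_add) gmod" and N :: "('x, 'k, 'n::ab_group_add) gmod"
    and \<iota> :: "'n \<Rightarrow> 'm"
  assumes P: "projective I P" and M: "gr_module I M" "locally_finite M"
    and N: "gr_module I N" and g: "ghom M N 0 g" and f: "ghom P N k f"
    and im: "\<And>p. p \<in> carr P \<Longrightarrow> f p \<in> g ` carr M"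
    and \<iota>: "inj \<iota>" "\<And>y z. \<iota> (y + z) = \<iota> y + \<iota> z"
  obtains h where "ghom P M k h" "\<And>p. p \<in> carr P \<Longrightarrow> g (h p) = f p"
proof -
  interpret g: gr_hom I M N 0 g
    using M N g by (simp add: gr_hom_def gr_hom_axioms_def)
  define M' where "M' = \<lparr>piece = (\<lambda>j. piece M (j + k)), act = act M\<rparr>"
  define N1 where "N1 = \<lparr>piece = (\<lambda>j. piece N (j + k)), act = act N\<rparr>"
  define N' where "N' = \<lparr>piece = (\<lambda>j. \<iota> ` g ` piece M' j), act = (\<lambda>a y. \<iota> (act N1 a (inv \<iota> y)))\<rparr>"
  have M'_gr: "gr_module I M'" and carr_M': "carr M' = carr M"
    unfolding M'_def by (rule shift_module[OF M(1)])+
  have N1_gr: "gr_module I N1" and carr_N1: "carr N1 = carr N"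
    unfolding N1_def by (rule shift_module[OF N])+
  have M'_lf: "locally_finite M'"
    using M(2) by (simp add: locally_finite_def M'_def)
  have g': "ghom M' N1 0 g"
    unfolding ghom_def carr_M'
    using g by (simp add: M'_def N1_def ghom_def)
  have N'_gr: "gr_module I N'" and N'_lf: "locally_finite N'" and carr_N': "carr N' = \<iota> ` g ` carr M'"
    and \<iota>g: "ghom M' N' 0 (\<lambda>m. \<iota> (g m))"
    unfolding N'_def by (rule image_module[OF M'_gr M'_lf N1_gr g' \<iota>])+
  have "ghom P N' 0 (\<lambda>p. \<iota> (f p))"
    unfolding ghom_def
  proof (intro conjI allI ballI subsetI)
    fix p q assume "p \<in> carr P" "q \<in> carr P"
    then show "\<iota> (f (p + q)) = \<iota> (f p) + \<iota> (f q)"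
      by (simp add: ghom_add[OF f] \<iota>(2))
  next
    fix a p assume "p \<in> carr P"
    then show "\<iota> (f (act P a p)) = act N' a (\<iota> (f p))"
      by (simp add: ghom_act[OF f] N'_def N1_def \<iota>(1))
  next
    fix j y assume "y \<in> (\<lambda>p. \<iota> (f p)) ` piece P j"
    then obtain p where p: "p \<in> piece P j" "y = \<iota> (f p)" by auto
    obtain m where m: "m \<in> carr M" "f p = g m"
      using im[OF piece_subset_carr[OF p(1)]] by auto
    obtain m' where "m' \<in> piece M (j + k)" "g m' = g m"
      using g.homogeneous_preimage[of m "j + k"] m ghom_piece[OF f p(1)] by auto
    then have "y \<in> \<iota> ` g ` piece M (j + k)"
      using p m by (metis imageI)
    then show "y \<in> piece N' (j + 0)"
      by (simp add: N'_def M'_def)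
  qed
  moreover have "(\<lambda>m. \<iota> (g m)) ` carr M' = carr N'"
    unfolding carr_N' by auto
  ultimately obtain h where h: "ghom P M' 0 h" "\<And>p. p \<in> carr P \<Longrightarrow> \<iota> (g (h p)) = \<iota> (f p)"
    using P M'_gr M'_lf N'_gr N'_lf \<iota>g unfolding projective_def gr_module_def by metis
  show ?thesis
  proof (rule that)
    show "ghom P M k h"
      using h(1) by (simp add: ghom_def M'_def)
    show "g (h p) = f p" if "p \<in> carr P" for p
      using h(2)[OF that] \<iota>(1) by (simp add: inj_eq)
  qed
qed

lemma projective_resolutionD:
  assumes "projective_resolution I P d \<epsilon>"
  shows "projective I (P n)" and "gr_module I (P n)" and "locally_finite (P n)"
    and "ghom (P (Suc n)) (P n) 0 (d n)" and "ghom (P 0) trivial_module 0 \<epsilon>"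
    and "\<epsilon> ` carr (P 0) = UNIV"
    and "p \<in> carr (P 0) \<Longrightarrow> \<epsilon> p = 0 \<Longrightarrow> p \<in> d 0 ` carr (P (Suc 0))"
    and "p \<in> carr (P (Suc n)) \<Longrightarrow> d n p = 0 \<Longrightarrow> p \<in> d (Suc n) ` carr (P (Suc (Suc n)))"
    and "p \<in> carr (P (Suc 0)) \<Longrightarrow> \<epsilon> (d 0 p) = 0"
    and "p \<in> carr (P (Suc (Suc n))) \<Longrightarrow> d n (d (Suc n) p) = 0"
proof -
  note * = assms[unfolded projective_resolution_def]
  show 1: "projective I (P n)" using * by simp
  then show "gr_module I (P n)" "locally_finite (P n)"
    by (simp_all add: projective_gr_module projective_locally_finite)
  show "ghom (P (Suc n)) (P n) 0 (d n)" "ghom (P 0) trivial_module 0 \<epsilon>" "\<epsilon> ` carr (P 0) = UNIV"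
    using * by simp_all
  have 2: "{p \<in> carr (P 0). \<epsilon> p = 0} = d 0 ` carr (P (Suc 0))"
    "{p \<in> carr (P (Suc n)). d n p = 0} = d (Suc n) ` carr (P (Suc (Suc n)))" for n
    using * by simp_all
  show "p \<in> carr (P 0) \<Longrightarrow> \<epsilon> p = 0 \<Longrightarrow> p \<in> d 0 ` carr (P (Suc 0))"
    "p \<in> carr (P (Suc 0)) \<Longrightarrow> \<epsilon> (d 0 p) = 0"
    using 2(1) by auto
  show "p \<in> carr (P (Suc n)) \<Longrightarrow> d n p = 0 \<Longrightarrow> p \<in> d (Suc n) ` carr (P (Suc (Suc n)))"
    "p \<in> carr (P (Suc (Suc n))) \<Longrightarrow> d n (d (Suc n) p) = 0"
    using 2(2)[of n] by auto
qed

text \<open>The comparison theorem. The cocycle \<open>f\<close> may have any internal degree \<open>k\<close>, and \<open>X\<close> need only be a complex of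
projectives, so this yields chain maps between resolutions as well as the lifts that define Yoneda products,
where \<open>X\<close> is a truncated resolution. The recursion carries along that \<open>G\<close> composed with the differential
has its image in the next image of \<open>dY\<close>, which is what the next lifting step needs.\<close>

lemma chain_map_exists:
  fixes X Y :: "nat \<Rightarrow> ('x, 'k::field, nat \<Rightarrow>\<^sub>0 'k) gmod"
  assumes aug: "\<And>a. a \<in> I \<Longrightarrow> lookup a [] = 0"
    and Y: "projective_resolution I Y dY \<epsilon>"
    and X: "\<And>i. projective I (X i)" "\<And>i. ghom (X (Suc i)) (X i) 0 (dX i)"
      "\<And>i p. p \<in> carr (X (Suc (Suc i))) \<Longrightarrow> dX i (dX (Suc i) p) = 0"
    and f: "ghom (X 0) trivial_module k f" "\<And>p. p \<in> carr (X (Suc 0)) \<Longrightarrow> f (dX 0 p) = 0"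
  obtains F where "\<And>i. ghom (X i) (Y i) k (F i)"
    and "\<And>p. p \<in> carr (X 0) \<Longrightarrow> \<epsilon> (F 0 p) = f p"
    and "\<And>i p. p \<in> carr (X (Suc i)) \<Longrightarrow> dY i (F (Suc i) p) = F i (dX i p)"
proof -
  note Y = projective_resolutionD[OF Y]
  have Xgr: "gr_module I (X i)" for i
    using X(1) by (rule projective_gr_module)
  have triv: "gr_module I (trivial_module :: ('x, 'k, 'k) gmod)"
    using aug by (rule graded_trivial_module)
  have dX_carr: "dX i p \<in> carr (X i)" if "p \<in> carr (X (Suc i))" for i p
    using gr_hom.carr[of I "X (Suc i)" "X i" 0 "dX i" p] Xgr X(2) that
    by (simp add: gr_hom_def gr_hom_axioms_def)
  define good where "good i G \<longleftrightarrow> ghom (X i) (Y i) k G \<and> (i = 0 \<longrightarrow> (\<forall>p\<in>carr (X 0). \<epsilon> (G p) = f p))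
    \<and> (\<forall>p\<in>carr (X (Suc i)). G (dX i p) \<in> dY i ` carr (Y (Suc i)))" for i G
  have base: "\<exists>G. good 0 G"
  proof -
    obtain G where G: "ghom (X 0) (Y 0) k G" "\<And>p. p \<in> carr (X 0) \<Longrightarrow> \<epsilon> (G p) = f p"
    proof (rule projective_lift[OF X(1) Y(2,3) triv Y(5) f(1)])
      show "f p \<in> \<epsilon> ` carr (Y 0)" for p
        by (simp add: Y(6))
      \<comment> \<open>the field embedded into the common carrier type\<close>
      show "inj (single 0 :: 'k \<Rightarrow> nat \<Rightarrow>\<^sub>0 'k)"
        by simp
    qed (auto simp: single_add)
    have "G (dX 0 p) \<in> dY 0 ` carr (Y (Suc 0))" if "p \<in> carr (X (Suc 0))" for p
    proof (rule Y(7))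
      show "G (dX 0 p) \<in> carr (Y 0)"
        using gr_hom.carr[of I "X 0" "Y 0" k G] Xgr Y(2) G(1) dX_carr[OF that]
        by (simp add: gr_hom_def gr_hom_axioms_def)
      show "\<epsilon> (G (dX 0 p)) = 0"
        using G(2)[OF dX_carr[OF that]] f(2)[OF that] by simp
    qed
    then show ?thesis
      using G unfolding good_def by auto
  qed
  have step: "\<exists>G'. good (Suc i) G' \<and> (\<forall>p\<in>carr (X (Suc i)). dY i (G' p) = G (dX i p))" if G: "good i G" for i G
  proof -
    have Gh: "ghom (X i) (Y i) k G" using G by (simp add: good_def)
    have comp: "ghom (X (Suc i)) (Y i) (0 + k) (\<lambda>p. G (dX i p))"
      by (rule ghom_compose[OF Xgr Xgr X(2) Gh])
    obtain G' where G': "ghom (X (Suc i)) (Y (Suc i)) k G'"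
      "\<And>p. p \<in> carr (X (Suc i)) \<Longrightarrow> dY i (G' p) = G (dX i p)"
    proof (rule projective_lift[OF X(1) Y(2,3) Y(2) Y(4), where \<iota> = "\<lambda>y. y"])
      show "ghom (X (Suc i)) (Y i) k (\<lambda>p. G (dX i p))"
        using comp by simp
      show "G (dX i p) \<in> dY i ` carr (Y (Suc i))" if "p \<in> carr (X (Suc i))" for p
        using G that by (auto simp: good_def)
    qed auto
    have "G' (dX (Suc i) p) \<in> dY (Suc i) ` carr (Y (Suc (Suc i)))" if "p \<in> carr (X (Suc (Suc i)))" for p
    proof (rule Y(8))
      show "G' (dX (Suc i) p) \<in> carr (Y (Suc i))"
        using gr_hom.carr[of I "X (Suc i)" "Y (Suc i)" k G'] Xgr Y(2) G'(1) dX_carr[OF that]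
        by (simp add: gr_hom_def gr_hom_axioms_def)
      show "dY i (G' (dX (Suc i) p)) = 0"
        using G'(2)[OF dX_carr[OF that]] X(3)[OF that] ghom_zero[OF Gh] by simp
    qed
    then show ?thesis
      using G' unfolding good_def by auto
  qed
  obtain F where F: "\<And>i. good i (F i)" "\<And>i. \<forall>p\<in>carr (X (Suc i)). dY i (F (Suc i) p) = F i (dX i p)"
    using dependent_nat_choice[of good "\<lambda>i G G'. \<forall>p\<in>carr (X (Suc i)). dY i (G' p) = G (dX i p)"]
      base step by metis
  show ?thesis
    by (rule that[of F]) (use F in \<open>auto simp: good_def\<close>)
qed

text \<open>Two chain maps over the same map of augmentations are homotopic, and a homotopy \<open>s\<close> writes the difference of
the two pullbacks of a cocycle \<open>f\<close> as the coboundary of \<open>f\<close> composed with \<open>s\<close>.\<close>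

lemma chain_maps_cohomologous:
  fixes X Y :: "nat \<Rightarrow> ('x, 'k::field, nat \<Rightarrow>\<^sub>0 'k) gmod"
  assumes aug: "\<And>a. a \<in> I \<Longrightarrow> lookup a [] = 0"
    and Y: "projective_resolution I Y dY \<epsilon>"
    and X: "\<And>i. projective I (X i)" "\<And>i. ghom (X (Suc i)) (X i) 0 (dX i)"
      "\<And>i p. p \<in> carr (X (Suc (Suc i))) \<Longrightarrow> dX i (dX (Suc i) p) = 0"
    and \<alpha>: "\<And>i. ghom (X i) (Y i) 0 (\<alpha> i)"
      "\<And>i p. p \<in> carr (X (Suc i)) \<Longrightarrow> dY i (\<alpha> (Suc i) p) = \<alpha> i (dX i p)"
    and \<beta>: "\<And>i. ghom (X i) (Y i) 0 (\<beta> i)"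
      "\<And>i p. p \<in> carr (X (Suc i)) \<Longrightarrow> dY i (\<beta> (Suc i) p) = \<beta> i (dX i p)"
    and eq: "\<And>p. p \<in> carr (X 0) \<Longrightarrow> \<epsilon> (\<alpha> 0 p) = \<epsilon> (\<beta> 0 p)"
    and f: "ext_cocycle Y dY n m f"
  shows "ext_coboundary X dX n m (\<lambda>p. f (\<alpha> n p) - f (\<beta> n p))"
proof -
  note Y = projective_resolutionD[OF Y]
  have Xgr: "gr_module I (X i)" for i
    using X(1) by (rule projective_gr_module)
  have triv: "gr_module I (trivial_module :: ('x, 'k, 'k) gmod)"
    using aug by (rule graded_trivial_module)
  define \<delta> where "\<delta> i p = \<alpha> i p - \<beta> i p" for i p
  have \<delta>: "ghom (X i) (Y i) 0 (\<delta> i)" for i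
    unfolding \<delta>_def using ghom_diff[OF Xgr Y(2) \<alpha>(1) \<beta>(1)] .
  interpret dX: gr_hom I "X (Suc i)" "X i" 0 "dX i" for i
    using Xgr X(2) by (simp add: gr_hom_def gr_hom_axioms_def)
  interpret dY: gr_hom I "Y (Suc i)" "Y i" 0 "dY i" for i
    using Y by (simp add: gr_hom_def gr_hom_axioms_def)
  interpret \<alpha>: gr_hom I "X i" "Y i" 0 "\<alpha> i" for i
    using Y Xgr \<alpha>(1) by (simp add: gr_hom_def gr_hom_axioms_def)
  interpret \<beta>: gr_hom I "X i" "Y i" 0 "\<beta> i" for i
    using Y Xgr \<beta>(1) by (simp add: gr_hom_def gr_hom_axioms_def)
  interpret \<delta>: gr_hom I "X i" "Y i" 0 "\<delta> i" for i
    using Y Xgr \<delta> by (simp add: gr_hom_def gr_hom_axioms_def)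
  interpret \<epsilon>: gr_hom I "Y 0" trivial_module 0 \<epsilon>
    using Y triv by (simp add: gr_hom_def gr_hom_axioms_def)
  have \<delta>_chain: "dY i (\<delta> (Suc i) p) = \<delta> i (dX i p)" if "p \<in> carr (X (Suc i))" for i p
    using that by (simp add: \<delta>_def dY.diff \<alpha>.carr \<beta>.carr \<alpha>(2) \<beta>(2))
  define good where "good i s \<longleftrightarrow> ghom (X i) (Y (Suc i)) 0 s
    \<and> (i = 0 \<longrightarrow> (\<forall>p\<in>carr (X 0). dY 0 (s p) = \<delta> 0 p))
    \<and> (\<forall>p\<in>carr (X (Suc i)). dY i (s (dX i p)) = \<delta> i (dX i p))" for i s
  have base: "\<exists>s. good 0 s"
  proof -
    obtain s where "ghom (X 0) (Y (Suc 0)) 0 s" "\<And>p. p \<in> carr (X 0) \<Longrightarrow> dY 0 (s p) = \<delta> 0 p"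
    proof (rule projective_lift[OF X(1) Y(2,3) Y(2) Y(4) \<delta>, where \<iota> = "\<lambda>y. y"])
      show "\<delta> 0 p \<in> dY 0 ` carr (Y (Suc 0))" if "p \<in> carr (X 0)" for p
        by (rule Y(7)) (use that eq in \<open>simp_all add: \<delta>.carr, simp add: \<delta>_def \<epsilon>.diff \<alpha>.carr \<beta>.carr\<close>)
    qed auto
    then show ?thesis
      unfolding good_def using dX.carr by auto
  qed
  have step: "\<exists>t. good (Suc i) t \<and> (\<forall>p\<in>carr (X (Suc i)). dY (Suc i) (t p) = \<delta> (Suc i) p - s (dX i p))"
    if s: "good i s" for i s
  proof -
    have sh: "ghom (X i) (Y (Suc i)) 0 s" using s by (simp add: good_def)
    interpret s: gr_hom I "X i" "Y (Suc i)" 0 s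
      using Y Xgr sh by (simp add: gr_hom_def gr_hom_axioms_def)
    have "ghom (X (Suc i)) (Y (Suc i)) (0 + 0) (\<lambda>p. s (dX i p))"
      by (rule ghom_compose[OF Xgr Xgr X(2) sh])
    then have diff: "ghom (X (Suc i)) (Y (Suc i)) 0 (\<lambda>p. \<delta> (Suc i) p - s (dX i p))"
      using ghom_diff[OF Xgr Y(2) \<delta>] by simp
    obtain t where t: "ghom (X (Suc i)) (Y (Suc (Suc i))) 0 t"
      "\<And>p. p \<in> carr (X (Suc i)) \<Longrightarrow> dY (Suc i) (t p) = \<delta> (Suc i) p - s (dX i p)"
    proof (rule projective_lift[OF X(1) Y(2,3) Y(2) Y(4) diff, where \<iota> = "\<lambda>y. y"])
      fix p assume p: "p \<in> carr (X (Suc i))"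
      show "\<delta> (Suc i) p - s (dX i p) \<in> dY (Suc i) ` carr (Y (Suc (Suc i)))"
      proof (rule Y(8))
        show "\<delta> (Suc i) p - s (dX i p) \<in> carr (Y (Suc i))"
          using p by (intro gr_module.carr_diff[OF Y(2)] \<delta>.carr s.carr dX.carr)
        show "dY i (\<delta> (Suc i) p - s (dX i p)) = 0"
          using p s by (simp add: dY.diff \<delta>.carr s.carr dX.carr \<delta>_chain good_def)
      qed
    qed auto
    have "dY (Suc i) (t (dX (Suc i) p)) = \<delta> (Suc i) (dX (Suc i) p)" if "p \<in> carr (X (Suc (Suc i)))" for p
      using that by (simp add: t(2) dX.carr X(3) ghom_zero[OF sh])
    then show ?thesis
      using t unfolding good_def by auto
  qed
  obtain s where s: "\<And>i. good i (s i)"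
    "\<And>i. \<forall>p\<in>carr (X (Suc i)). dY (Suc i) (s (Suc i) p) = \<delta> (Suc i) p - s i (dX i p)"
    using dependent_nat_choice[of good "\<lambda>i s t. \<forall>p\<in>carr (X (Suc i)). dY (Suc i) (t p) = \<delta> (Suc i) p - s (dX i p)"]
      base step by metis
  have sh: "ghom (X i) (Y (Suc i)) 0 (s i)" for i
    using s(1) by (simp add: good_def)
  have fh: "ghom (Y n) trivial_module (- m) f" and fd: "\<And>p. p \<in> carr (Y (Suc n)) \<Longrightarrow> f (dY n p) = 0"
    using f by (simp_all add: ext_cocycle_def)
  interpret s: gr_hom I "X i" "Y (Suc i)" 0 "s i" for i
    using Y Xgr sh by (simp add: gr_hom_def gr_hom_axioms_def)
  interpret f: gr_hom I "Y n" trivial_module "- m" f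
    using Y triv fh by (simp add: gr_hom_def gr_hom_axioms_def)
  have f\<delta>: "f (\<alpha> n p) - f (\<beta> n p) = f (\<delta> n p)" if "p \<in> carr (X n)" for p
    using that by (simp add: \<delta>_def f.diff \<alpha>.carr \<beta>.carr)
  show ?thesis
  proof (cases n)
    case 0
    have "f (\<delta> n p) = 0" if "p \<in> carr (X n)" for p
      using s(1)[of 0] fd[of "s 0 p"] s.carr[of p 0] that by (auto simp: good_def 0)
    then show ?thesis
      using f\<delta> by (simp add: ext_coboundary_def 0)
  next
    case (Suc k)
    have "f (\<delta> n p) = f (s k (dX k p))" if "p \<in> carr (X n)" for p
    proof -
      have "f (\<delta> n p - s k (dX k p)) = 0"
        using s(2)[of k] that fd[of "s (Suc k) p"] s.carr[of p "Suc k"] by (auto simp: Suc)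
      moreover have "s k (dX k p) \<in> carr (Y n)" "\<delta> n p \<in> carr (Y n)"
        using that \<delta>.carr by (auto simp: Suc intro!: s.carr dX.carr)
      ultimately show ?thesis
        by (simp add: f.diff)
    qed
    moreover have "ghom (X k) trivial_module (- m) (\<lambda>p. f (s k p))"
      using ghom_compose[OF Xgr Y(2) sh[of k], of trivial_module "- m" f] fh by (simp add: Suc)
    ultimately show ?thesis
      using f\<delta> unfolding ext_coboundary_def Suc by (auto simp: Suc)
  qed
qed

text \<open>Only the values on the carrier matter, as two cochains that agree there differ by the coboundary of 0.\<close>

lemma yoneda_generated_cong:
  assumes "yoneda_generated P d \<epsilon> D n m f" "ext_cocycle P d n m g"
    and "\<And>p. p \<in> carr (P n) \<Longrightarrow> f p = g p"
  shows "yoneda_generated P d \<epsilon> D n m g"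
proof (rule yoneda_generated.cohomologous[OF assms(1,2)])
  have "ghom (P k) trivial_module (- m) (\<lambda>_. 0)" for k
    by (simp add: ghom_def act_trivial_module piece_trivial_module image_subset_iff)
  then show "ext_coboundary P d n m (\<lambda>p. g p - f p)"
    using assms(3) by (auto simp: ext_coboundary_def split: nat.split)
qed

lemma yoneda_generated_sum:
  "finite C \<Longrightarrow> (\<And>c. c \<in> C \<Longrightarrow> yoneda_generated P d \<epsilon> D n m (f c))
    \<Longrightarrow> yoneda_generated P d \<epsilon> D n m (\<lambda>p. \<Sum>c\<in>C. f c p)"
  by (induction C rule: finite_induct) (auto intro: yoneda_generated.zero yoneda_generated.add)

section \<open>Words and chains of a monomial algebra\<close>

lemma mon_eq_iff: "(mon u :: ('x, 'k::field) free_alg) = mon v \<longleftrightarrow> u = v"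
  unfolding mon_def by (metis lookup_single_eq lookup_single_not_eq zero_neq_one)

lemma lookup_mult_mon:
  fixes p :: "('x, 'k::field) free_alg"
  shows "lookup (p * mon z) w = (\<Sum>v. lookup p v when w = v @ z)"
proof -
  have "(\<Sum>q. lookup (mon z :: ('x, 'k) free_alg) q when w = l + q) = (1 when w = l @ z)" for l
  proof -
    have "(\<Sum>q. lookup (mon z :: ('x, 'k) free_alg) q when w = l + q)
        = (\<Sum>q. ((1 when w = l @ q) when q = z))"
      by (intro Sum_any.cong) (auto simp: mon_def lookup_single when_def plus_list_def)
    then show ?thesis by simp
  qed
  then show ?thesis
    unfolding lookup_mult by (auto intro!: Sum_any.cong simp: when_def)
qed

lemma lookup_mult_mon_append:
  fixes p :: "('x, 'k::field) free_alg"
  shows "lookup (p * mon z) (v @ z) = lookup p v"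
proof -
  have "lookup (p * mon z) (v @ z) = (\<Sum>v'. lookup p v' when v' = v)"
    unfolding lookup_mult_mon by (intro Sum_any.cong) (auto simp: when_def)
  then show ?thesis by simp
qed

lemma lookup_mult_mon_neq_0:
  fixes p :: "('x, 'k::field) free_alg"
  assumes "lookup (p * mon z) w \<noteq> 0"
  obtains v where "w = v @ z" "lookup p v \<noteq> 0"
proof -
  have "w \<in> keys (p * mon z)"
    using assms by (simp add: in_keys_iff)
  with keys_mult[of p "mon z"] obtain v where "w = v + z" "v \<in> keys p"
    by (auto simp: mon_def)
  then show ?thesis
    using that by (simp add: plus_list_def in_keys_iff)
qed

lemma lookup_mon_mult_append:
  fixes p :: "('x, 'k::field) free_alg"
  shows "lookup (mon u * p) (u @ v) = lookup p v"
proof -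
  have "lookup (mon u * p) (u @ v)
      = (\<Sum>l. (\<Sum>q. lookup p q when u @ v = l + q) when l = u)"
    unfolding lookup_mult by (intro Sum_any.cong) (auto simp: mon_def lookup_single when_def)
  also have "\<dots> = (\<Sum>q. lookup p q when q = v)"
    by (auto intro!: Sum_any.cong simp: plus_list_def when_def)
  finally show ?thesis by simp
qed

lemma lookup_mon_mult_neq_0:
  fixes p :: "('x, 'k::field) free_alg"
  assumes "lookup (mon u * p) w \<noteq> 0"
  obtains v where "w = u @ v" "lookup p v \<noteq> 0"
proof -
  have "w \<in> keys (mon u * p)"
    using assms by (simp add: in_keys_iff)
  with keys_mult[of "mon u" p] obtain v where "w = u + v" "v \<in> keys p"
    by (auto simp: mon_def)
  then show ?thesis
    using that by (simp add: plus_list_def in_keys_iff)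
qed

locale monomial_algebra =
  fixes I :: "('x::finite, 'k::field) free_alg set" and R :: "'x list set"
  assumes finite_R: "finite R"
    and length_R: "r \<in> R \<Longrightarrow> length r \<ge> 2"
    and minimal: "minimal_generators I (mon ` R)"
begin

text \<open>The words whose image in \<open>A\<close> is 0; see \<open>mon_in_ideal_iff\<close>.\<close>

definition vanishing :: "'x list \<Rightarrow> bool"
  where "vanishing w \<longleftrightarrow> (\<exists>r\<in>R. sublist r w)"

lemma vanishing_mono: "vanishing u \<Longrightarrow> sublist u w \<Longrightarrow> vanishing w"
  unfolding vanishing_def using sublist_order.order_trans by blast

lemma not_vanishing_short: "length w < 2 \<Longrightarrow> \<not> vanishing w"
  unfolding vanishing_def using length_R sublist_length_le by fastforce

lemma ideal: "two_sided_ideal I"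
  using minimal two_sided_ideal_ideal_gen by (auto simp: minimal_generators_def)

lemma ideal_zero: "0 \<in> I"
  and ideal_add: "a \<in> I \<Longrightarrow> b \<in> I \<Longrightarrow> a + b \<in> I"
  and ideal_mult: "a \<in> I \<Longrightarrow> s * a * t \<in> I"
  using ideal by (auto simp: two_sided_ideal_def)

lemma ideal_mult_left: "a \<in> I \<Longrightarrow> s * a \<in> I"
  using ideal_mult[of a s 1] by simp

lemma ideal_mult_right: "a \<in> I \<Longrightarrow> a * t \<in> I"
  using ideal_mult[of a 1 t] by simp

lemma ideal_sum:
  "(\<And>j. j \<in> J \<Longrightarrow> a j \<in> I) \<Longrightarrow> (\<Sum>j\<in>J. a j) \<in> I"
  by (induction J rule: infinite_finite_induct) (auto intro: ideal_add ideal_zero)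

text \<open>The elements all of whose words contain a relation form an ideal.\<close>

lemma ideal_keys_vanish:
  assumes "p \<in> I" "w \<in> keys p"
  shows "vanishing w"
proof -
  let ?J = "{p :: ('x, 'k) free_alg. \<forall>w\<in>keys p. vanishing w}"
  have "two_sided_ideal ?J"
    unfolding two_sided_ideal_def
  proof (intro conjI ballI allI)
    fix a b assume "a \<in> ?J" "b \<in> ?J"
    then show "a + b \<in> ?J"
      using keys_add[of a b] by auto
  next
    fix a s t :: "('x, 'k) free_alg" assume a: "a \<in> ?J"
    have "vanishing w" if w: "w \<in> keys (s * a * t)" for w
    proof -
      obtain u v where uv: "w = u + v" "u \<in> keys (s * a)"
        using keys_mult[of "s * a" t] w by auto
      obtain x y where xy: "u = x + y" "y \<in> keys a"
        using keys_mult[of s a] uv(2) by auto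
      have "vanishing y" using a xy(2) by auto
      moreover have "sublist y w"
        unfolding uv(1) xy(1) plus_list_def sublist_def by auto
      ultimately show ?thesis by (rule vanishing_mono)
    qed
    then show "s * a * t \<in> ?J" by simp
  qed simp
  moreover have "mon ` R \<subseteq> ?J"
    by (auto simp: mon_def vanishing_def)
  ultimately have "two_sided_ideal hull (mon ` R) \<subseteq> ?J"
    by (intro hull_minimal) auto
  then show ?thesis
    using assms minimal by (auto simp: minimal_generators_def ideal_gen_def)
qed

lemma mon_append3_in_ideal_gen:
  assumes "mon r \<in> ideal_gen G"
  shows "mon (u @ r @ v) \<in> ideal_gen G"
  using assms two_sided_ideal_ideal_gen[of G]
  by (simp add: mon_append two_sided_ideal_def flip: mult.assoc)

lemma generators_in_ideal_gen: "G \<subseteq> ideal_gen G"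
  unfolding ideal_gen_def by (rule hull_subset)

lemma mon_in_ideal_iff: "mon w \<in> I \<longleftrightarrow> vanishing w"
proof
  assume "mon w \<in> I"
  then show "vanishing w" by (rule ideal_keys_vanish) (simp add: mon_def)
next
  assume "vanishing w"
  then obtain r u v where r: "r \<in> R" "w = u @ r @ v"
    unfolding vanishing_def sublist_def by auto
  have "mon r \<in> ideal_gen (mon ` R)"
    using generators_in_ideal_gen r(1) by blast
  then show "mon w \<in> I"
    unfolding r(2) using minimal mon_append3_in_ideal_gen by (metis minimal_generators_def)
qed

lemma ideal_iff: "p \<in> I \<longleftrightarrow> (\<forall>w\<in>keys p. vanishing w)"
proof
  assume van: "\<forall>w\<in>keys p. vanishing w"
  have "single w c \<in> I" if "vanishing w" for w c
  proof -
    have "single w c = scalar c * mon w"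
      by (simp add: mon_def scalar_def mult_single plus_list_def)
    then show ?thesis
      using ideal_mult_left[of "mon w" "scalar c"] that by (simp add: mon_in_ideal_iff)
  qed
  then have "(\<Sum>w\<in>keys p. single w (lookup p w)) \<in> I"
    using van by (intro ideal_sum) auto
  then show "p \<in> I"
    by (simp add: poly_mapping_sum_single)
qed (auto intro: ideal_keys_vanish)

text \<open>A relation that contains another one would be redundant, against the minimality of the generating set.\<close>

lemma antichain:
  assumes "r \<in> R" "r' \<in> R" "sublist r r'"
  shows "r = r'"
proof (rule ccontr)
  assume "r \<noteq> r'"
  let ?G = "mon ` (R - {r'}) :: ('x, 'k) free_alg set"
  have "mon r \<in> ideal_gen ?G"
    using generators_in_ideal_gen[of ?G] assms(1) \<open>r \<noteq> r'\<close> by blast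
  then have "mon r' \<in> ideal_gen ?G"
    using assms(3) mon_append3_in_ideal_gen by (auto simp: sublist_def)
  then have "mon ` R \<subseteq> ideal_gen ?G"
    using generators_in_ideal_gen[of ?G] by blast
  then have "ideal_gen (mon ` R) \<subseteq> ideal_gen ?G"
    unfolding ideal_gen_def[of "mon ` R"] by (intro hull_minimal two_sided_ideal_ideal_gen)
  moreover have "ideal_gen ?G \<subseteq> ideal_gen (mon ` R)"
    unfolding ideal_gen_def by (intro hull_mono) auto
  moreover have "mon r' \<notin> ?G"
    by (auto simp: mon_eq_iff)
  then have "?G \<subset> mon ` R"
    using assms(2) by blast
  ultimately show False
    using minimal unfolding minimal_generators_def by (metis subset_antisym)
qed

text \<open>For \<open>z\<close> nonzero in \<open>A\<close>, \<open>y\<close> is one of the monomial generators of its left annihilator. This is the condition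
on \<open>LE R\<close> and \<open>L\<close> in the definition of \<open>S\<close>, see \<open>min_ann_iff\<close>, in a form that refers to words only.\<close>

definition min_ann :: "'x list \<Rightarrow> 'x list \<Rightarrow> bool"
  where "min_ann y z \<longleftrightarrow> vanishing (y @ z) \<and> \<not> vanishing y \<and>
    (\<forall>y'. strict_suffix y' y \<longrightarrow> \<not> vanishing (y' @ z))"

text \<open>A relation inside \<open>y z\<close> must begin where \<open>y\<close> begins, as otherwise a proper right end of \<open>y\<close>
would annihilate \<open>z\<close>, and it must reach into \<open>z\<close>, as \<open>y\<close> is nonzero in \<open>A\<close>. In particular \<open>y\<close> lies
in \<open>LE R\<close>.\<close>

lemma min_ann_generator:
  assumes "min_ann y z" "\<not> vanishing z"
  obtains b v where "b \<noteq> []" "y @ b \<in> R" "z = b @ v"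
proof -
  obtain r u v where r: "r \<in> R" "y @ z = u @ r @ v"
    using assms(1) unfolding min_ann_def vanishing_def sublist_def by auto
  have u: "u = []"
  proof (rule ccontr)
    assume "u \<noteq> []"
    from r(2) consider us where "y = u @ us" "us @ z = r @ v" | us where "u = y @ us" "z = us @ r @ v"
      unfolding append_eq_append_conv2 by auto
    then show False
    proof cases
      case 1
      then have "strict_suffix us y" "vanishing (us @ z)"
        using \<open>u \<noteq> []\<close> r(1) by (auto simp: strict_suffix_def suffix_def vanishing_def)
      then show False using assms(1) by (simp add: min_ann_def)
    next
      case 2
      then show False using assms(2) r(1) by (auto simp: vanishing_def sublist_def)
    qed
  qed
  with r(2) consider us where "y = r @ us" | us where "r = y @ us" "z = us @ v"
    by (auto simp: append_eq_append_conv2)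
  then show ?thesis
  proof cases
    case 1
    then show ?thesis using assms(1) r(1) by (auto simp: min_ann_def vanishing_def)
  next
    case 2
    have "us \<noteq> []"
      using assms(1) r(1) 2(1) by (auto simp: min_ann_def vanishing_def)
    then show ?thesis using that 2 r(1) by blast
  qed
qed

text \<open>\<open>L\<close> selects the shortest right end, which is \<open>y\<close> itself exactly if no proper right end will do. That
\<open>y\<close> is nonzero in \<open>A\<close> corresponds to \<open>y \<in> LE R\<close>: a proper left end of a relation contains no relation,
and the converse is \<open>min_ann_generator\<close>.\<close>

lemma min_ann_iff:
  assumes "\<not> vanishing z"
  shows "min_ann y z \<longleftrightarrow> y \<in> LE R \<and> L I y z = mon y"
proof -
  let ?P = "\<lambda>y'. suffix y' y \<and> vanishing (y' @ z)"
  let ?m = "ARG_MIN length y'. ?P y'"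
  have m: "?P ?m" "\<And>y'. ?P y' \<Longrightarrow> length ?m \<le> length y'" if "vanishing (y @ z)"
    using arg_min_nat_lemma[of ?P y length] that by auto
  have L: "L I y z = (if vanishing (y @ z) then mon ?m else 0)"
    by (simp add: L_def mon_in_ideal_iff)
  show ?thesis
  proof
    assume y: "min_ann y z"
    then have van: "vanishing (y @ z)" by (simp add: min_ann_def)
    have "?m = y"
      using m[OF van] y unfolding min_ann_def strict_suffix_def by blast
    moreover have "y \<in> LE R"
      using min_ann_generator[OF y assms] unfolding LE_def by blast
    ultimately show "y \<in> LE R \<and> L I y z = mon y"
      using L van by simp
  next
    assume y: "y \<in> LE R \<and> L I y z = mon y"
    have "mon y \<noteq> (0 :: ('x, 'k) free_alg)"
      unfolding mon_def by (metis lookup_single_eq lookup_zero zero_neq_one)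
    with y L have van: "vanishing (y @ z)" and my: "?m = y"
      by (auto simp: mon_eq_iff split: if_splits)
    have "\<not> vanishing y"
    proof
      assume "vanishing y"
      then obtain r where r: "r \<in> R" "sublist r y" by (auto simp: vanishing_def)
      obtain b where b: "length b > 0" "y @ b \<in> R" using y by (auto simp: LE_def)
      have "sublist r (y @ b)" using r(2) by (auto intro: sublist_appendI simp: sublist_append)
      then have "r = y @ b" using antichain r(1) b(2) by blast
      then show False using r(2) b(1) sublist_length_le by fastforce
    qed
    moreover have "\<not> vanishing (y' @ z)" if "strict_suffix y' y" for y'
    proof
      assume "vanishing (y' @ z)"
      then have "length y \<le> length y'"
        using m(2)[OF van, of y'] my that by (simp add: strict_suffix_def)
      then show False
        using that by (auto simp: strict_suffix_def suffix_def)
    qed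
    ultimately show "min_ann y z"
      using van by (simp add: min_ann_def)
  qed
qed

text \<open>The generators of the resolution. A word \<open>w\<close> annihilates the first entry of a chain exactly if it has
a right end by which the chain can be extended (\<open>chain_extension\<close>), and this right end is unique
(\<open>chain_suffix_unique\<close>). For the empty chain the role of the annihilator is played by the
augmentation ideal.\<close>

fun chain :: "'x list list \<Rightarrow> bool" where
  "chain [] \<longleftrightarrow> True"
| "chain [z] \<longleftrightarrow> length z = 1"
| "chain (y # z # t) \<longleftrightarrow> min_ann y z \<and> chain (z # t)"

lemma chain_tl: "chain (z # t) \<Longrightarrow> chain t"
  by (cases t) auto

lemma chain_hd: "chain (z # t) \<Longrightarrow> z \<noteq> [] \<and> \<not> vanishing z"
proof (induction t arbitrary: z)
  case Nil
  then show ?case using not_vanishing_short[of z] by auto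
next
  case (Cons u t)
  then have "\<not> vanishing u" by auto
  then show ?case using Cons.prems by (auto simp: min_ann_def)
qed

lemma chain_suffix_unique:
  assumes "chain (z # t)" "chain (z' # t)" "w @ z = w' @ z'"
  shows "z = z'"
proof (cases t)
  case Nil
  then show ?thesis using assms by simp
next
  case (Cons u s)
  have "suffix z (w @ z)" "suffix z' (w @ z)"
    using suffixI[of "w @ z" w z] suffixI[of "w' @ z'" w' z'] assms(3) by simp_all
  then have "suffix z z' \<or> suffix z' z"
    by (rule suffix_same_cases)
  then show ?thesis
    using assms(1,2) Cons by (auto simp: min_ann_def strict_suffix_def)
qed

lemma chain_extension:
  assumes "chain c" "\<not> vanishing w" "if c = [] then w \<noteq> [] else vanishing (w @ hd c)"
  obtains v y where "w = v @ y" "chain (y # c)"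
proof (cases c)
  case Nil
  then show ?thesis
    using that[of "butlast w" "[last w]"] assms(3) by simp
next
  case (Cons z t)
  let ?P = "\<lambda>y. suffix y w \<and> vanishing (y @ z)"
  have "?P w" using assms(3) Cons by simp
  then obtain y where y: "?P y" "\<And>y'. ?P y' \<Longrightarrow> length y \<le> length y'"
    using ex_has_least_nat[of ?P w length] by blast
  have "\<not> vanishing (y' @ z)" if "strict_suffix y' y" for y'
  proof
    assume "vanishing (y' @ z)"
    moreover have "suffix y' w"
      using that y(1) suffix_order.order_trans unfolding strict_suffix_def by blast
    ultimately have "length y \<le> length y'" using y(2) by blast
    then show False using that by (auto simp: strict_suffix_def suffix_def)
  qed
  moreover have "\<not> vanishing y"
    using y(1) assms(2) vanishing_mono[of y w] by (auto intro: suffix_imp_sublist)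
  ultimately have "chain (y # c)"
    using y(1) assms(1) Cons by (simp add: min_ann_def)
  then show ?thesis
    using that y(1) by (auto simp: suffix_def)
qed

lemma finite_extensions: "finite {z. chain (z # t)}"
proof (cases t)
  case Nil
  have "{z :: 'x list. length z = 1} = {z. set z \<subseteq> UNIV \<and> length z = 1}" by auto
  then show ?thesis using Nil finite_lists_length_eq[of "UNIV :: 'x set" 1] by simp
next
  case (Cons u s)
  have "z \<in> (\<Union>r\<in>R. set (prefixes r))" if "chain (z # t)" for z
  proof -
    have zu: "min_ann z u" "\<not> vanishing u"
      using that Cons chain_hd[of u s] by auto
    obtain b v where "z @ b \<in> R" by (rule min_ann_generator[OF zu])
    then show ?thesis by (intro UN_I[of "z @ b"]) (auto simp: prefix_def)
  qed
  then have "{z. chain (z # t)} \<subseteq> (\<Union>r\<in>R. set (prefixes r))" by auto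
  then show ?thesis
    by (rule finite_subset) (simp add: finite_R)
qed

lemma finite_chains: "finite {c. chain c \<and> length c = n}"
proof (induction n)
  case 0
  have "{c. chain c \<and> length c = 0} = {[]}" by auto
  then show ?case by simp
next
  case (Suc n)
  have "{c. chain c \<and> length c = Suc n} \<subseteq> (\<Union>t\<in>{c. chain c \<and> length c = n}. (\<lambda>z. z # t) ` {z. chain (z # t)})"
    by (auto simp: length_Suc_conv dest: chain_tl)
  then show ?case
    by (rule finite_subset) (simp add: Suc finite_extensions)
qed

lemma in_S_iff: "b \<in> S I R \<longleftrightarrow> (\<exists>t. chain (b # t))"
proof
  assume "b \<in> S I R"
  then show "\<exists>t. chain (b # t)"
  proof induction
    case (var x)
    show ?case by (rule exI[of _ "[]"]) simp
  next
    case (step b a)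
    then obtain t where t: "chain (b # t)" by blast
    then have "chain (a # b # t)"
      using step.hyps chain_hd[OF t] by (simp add: min_ann_iff)
    then show ?case by blast
  qed
next
  assume "\<exists>t. chain (b # t)"
  then obtain t where "chain (b # t)" by blast
  then show "b \<in> S I R"
  proof (induction t arbitrary: b)
    case Nil
    then show ?case by (auto simp: length_Suc_conv intro: S.var)
  next
    case (Cons z t)
    then have z: "chain (z # t)" and b: "min_ann b z" by auto
    show ?case
      using S.step[OF Cons.IH[OF z]] b chain_hd[OF z] by (simp add: min_ann_iff)
  qed
qed


section \<open>The minimal resolution\<close>

text \<open>The normal form of an element modulo \<open>I\<close>. Elements of \<open>A\<close> are represented by their normal forms, and the
multiplication of \<open>A\<close> is that of the free algebra followed by \<open>nf\<close>; in this way the module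
laws below are inherited from the ring structure of the free algebra.\<close>

definition nf :: "('x, 'k) free_alg \<Rightarrow> ('x, 'k) free_alg"
  where "nf = Poly_Mapping.mapp (\<lambda>w c. if vanishing w then 0 else c)"

lemma lookup_nf: "lookup (nf p) w = (if vanishing w then 0 else lookup p w)"
  by (simp add: nf_def lookup_mapp when_def in_keys_iff)

lemma nf_zero [simp]: "nf 0 = 0"
  by (rule poly_mapping_eqI) (simp add: lookup_nf)

lemma nf_add: "nf (p + q) = nf p + nf q"
  by (rule poly_mapping_eqI) (simp add: lookup_nf lookup_add)

lemma nf_sum: "nf (\<Sum>j\<in>J. p j) = (\<Sum>j\<in>J. nf (p j))"
  by (induction J rule: infinite_finite_induct) (auto simp: nf_add)

lemma nf_eqI: "p - q \<in> I \<Longrightarrow> nf p = nf q"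
  by (rule poly_mapping_eqI)
    (auto simp: lookup_nf ideal_iff in_keys_iff lookup_minus)

lemma nf_ideal: "p \<in> I \<Longrightarrow> nf p = 0"
  using nf_eqI[of p 0] by simp

lemma nf_diff_ideal: "nf p - p \<in> I"
  by (auto simp: ideal_iff in_keys_iff lookup_minus lookup_nf split: if_splits)

lemma nf_mult_nf_right: "nf (a * nf b) = nf (a * b)"
  by (rule nf_eqI) (simp add: ideal_mult_left nf_diff_ideal flip: right_diff_distrib)

lemma nf_mult_nf_left: "nf (nf a * b) = nf (a * b)"
  by (rule nf_eqI) (simp add: ideal_mult_right nf_diff_ideal flip: left_diff_distrib)

text \<open>A number for the basis element \<open>w\<close> times the generator \<open>c\<close>. Projectivity and \<open>K2\<close> refer to modules of
finitely supported functions on the natural numbers, so the resolution has to live there.\<close>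

definition code :: "'x list \<Rightarrow> 'x list list \<Rightarrow> nat"
  where "code w c = to_nat (w, c)"

lemma code_eq_iff [simp]: "code w c = code w' c' \<longleftrightarrow> w = w' \<and> c = c'"
  by (simp add: code_def)

text \<open>The coefficient, in the free algebra, of the generator \<open>c\<close>. An element of the resolution
is determined by these coefficients (\<open>coded_eqI\<close>), so identities in it are checked coefficientwise.\<close>

definition part :: "'x list list \<Rightarrow> (nat \<Rightarrow>\<^sub>0 'k) \<Rightarrow> ('x, 'k) free_alg"
  where "part c = Poly_Mapping.map_key (\<lambda>w. code w c)"

lemma lookup_part: "lookup (part c p) w = lookup p (code w c)"
  by (simp add: part_def map_key.rep_eq inj_def)

lemma part_zero [simp]: "part c 0 = 0"
  by (rule poly_mapping_eqI) (simp add: lookup_part)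

lemma part_add: "part c (p + q) = part c p + part c q"
  by (rule poly_mapping_eqI) (simp add: lookup_part lookup_add)

lemma part_sum: "part c (\<Sum>j\<in>J. p j) = (\<Sum>j\<in>J. part c (p j))"
  by (rule poly_mapping_eqI) (simp add: lookup_part lookup_sum)

lemma part_single:
  "part c (single (code w c') a) = (if c = c' then single w a else 0)"
  by (rule poly_mapping_eqI) (auto simp: lookup_part lookup_single when_def)

text \<open>This excludes the numbers that do not encode a pair; the coefficients in \<open>part\<close> do not see them.\<close>

definition coded :: "(nat \<Rightarrow>\<^sub>0 'k) \<Rightarrow> bool"
  where "coded p \<longleftrightarrow> (\<forall>k. lookup p k \<noteq> 0 \<longrightarrow> (\<exists>w c. k = code w c))"

lemma coded_zero [simp]: "coded 0"
  by (simp add: coded_def)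

lemma coded_add: "coded p \<Longrightarrow> coded q \<Longrightarrow> coded (p + q)"
  by (simp add: coded_def lookup_add) (metis add.right_neutral)

lemma coded_sum:
  "(\<And>j. j \<in> J \<Longrightarrow> coded (p j)) \<Longrightarrow> coded (\<Sum>j\<in>J. p j)"
  by (induction J rule: infinite_finite_induct) (auto simp: coded_add)

lemma coded_single [simp]: "coded (single (code w c) a)"
  by (auto simp: coded_def lookup_single when_def)

lemma coded_eqI:
  assumes "coded p" "coded q" "\<And>c. part c p = part c q"
  shows "p = q"
proof (rule poly_mapping_eqI)
  fix k
  show "lookup p k = lookup q k"
  proof (cases "\<exists>w c. k = code w c")
    case True
    then show ?thesis using assms(3) by (metis lookup_part)
  next
    case False
    then show ?thesis using assms(1,2) by (metis coded_def)
  qed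
qed

definition supp :: "(nat \<Rightarrow>\<^sub>0 'k) \<Rightarrow> 'x list list set"
  where "supp p = {c. part c p \<noteq> 0}"

lemma finite_supp [simp]: "finite (supp p)"
proof (rule finite_subset)
  show "supp p \<subseteq> (\<lambda>k. snd (from_nat k :: 'x list \<times> 'x list list)) ` keys p"
  proof
    fix c assume "c \<in> supp p"
    then obtain w where "lookup (part c p) w \<noteq> 0"
      unfolding supp_def using poly_mapping_eqI[of "part c p" 0] by auto
    then have "code w c \<in> keys p"
      by (simp add: in_keys_iff lookup_part)
    then show "c \<in> (\<lambda>k. snd (from_nat k :: 'x list \<times> 'x list list)) ` keys p"
      by (rule rev_image_eqI) (simp add: code_def)
  qed
qed simp

text \<open>The inverse construction to \<open>part\<close>: the element with the prescribed coefficients \<open>\<phi>\<close> at the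
generators in \<open>C\<close>.\<close>

definition assemble :: "'x list list set \<Rightarrow> ('x list list \<Rightarrow> ('x, 'k) free_alg) \<Rightarrow> (nat \<Rightarrow>\<^sub>0 'k)"
  where "assemble C \<phi> = (\<Sum>c\<in>C. \<Sum>w\<in>keys (\<phi> c).
    single (code w c) (lookup (\<phi> c) w))"

lemma coded_assemble: "coded (assemble C \<phi>)"
  unfolding assemble_def by (intro coded_sum) simp

lemma part_assemble:
  "finite C \<Longrightarrow> part c (assemble C \<phi>) = (if c \<in> C then \<phi> c else 0)"
proof -
  assume "finite C"
  have "part c (assemble C \<phi>) = (\<Sum>c'\<in>C. if c = c' then \<phi> c else 0)"
    unfolding assemble_def part_sum part_single
    by (intro sum.cong) (auto simp: poly_mapping_sum_single)
  then show ?thesis using \<open>finite C\<close> by simp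
qed

definition Q_act :: "('x, 'k) free_alg \<Rightarrow> (nat \<Rightarrow>\<^sub>0 'k) \<Rightarrow> (nat \<Rightarrow>\<^sub>0 'k)"
  where "Q_act a p = assemble (supp p) (\<lambda>c. nf (a * part c p))"

lemma part_Q_act: "part c (Q_act a p) = nf (a * part c p)"
  unfolding Q_act_def part_assemble[OF finite_supp] by (simp add: supp_def)

lemma coded_Q_act: "coded (Q_act a p)"
  unfolding Q_act_def by (rule coded_assemble)

text \<open>The internal degree of the generator \<open>c\<close>, i.e. the degree of the product of its entries.\<close>

definition wt :: "'x list list \<Rightarrow> int"
  where "wt c = int (length (concat c))"

definition Q :: "nat \<Rightarrow> ('x, 'k, nat \<Rightarrow>\<^sub>0 'k) gmod"
  where "Q n = \<lparr> piece = (\<lambda>j. {p. coded p \<and> (\<forall>w c. lookup (part c p) w \<noteq> 0 \<longrightarrow>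
      \<not> vanishing w \<and> chain c \<and> length c = n \<and> int (length w) + wt c = j)}), act = Q_act \<rparr>"

lemma piece_Q:
  "p \<in> piece (Q n) j \<longleftrightarrow> coded p \<and> (\<forall>w c. lookup (part c p) w \<noteq> 0 \<longrightarrow>
      \<not> vanishing w \<and> chain c \<and> length c = n \<and> int (length w) + wt c = j)"
  and act_Q [simp]: "act (Q n) = Q_act"
  by (simp_all add: Q_def)

lemma piece_Q_zero: "0 \<in> piece (Q n) j"
  by (simp add: piece_Q)

lemma piece_Q_add:
  "p \<in> piece (Q n) j \<Longrightarrow> q \<in> piece (Q n) j \<Longrightarrow> p + q \<in> piece (Q n) j"
  unfolding piece_Q by (simp add: coded_add part_add lookup_add) (metis add.right_neutral)

lemma piece_Q_sum:
  "(\<And>i. i \<in> J \<Longrightarrow> p i \<in> piece (Q n) j) \<Longrightarrow> (\<Sum>i\<in>J. p i) \<in> piece (Q n) j"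
  by (induction J rule: infinite_finite_induct) (auto simp: piece_Q_add piece_Q_zero)

lemma single_in_piece_Q:
  assumes "\<not> vanishing w" "chain c" "length c = n"
  shows "single (code w c) a \<in> piece (Q n) (int (length w) + wt c)"
  using assms by (auto simp: piece_Q part_single lookup_single when_def split: if_splits)

lemma carr_Q:
  "p \<in> carr (Q n) \<longleftrightarrow> coded p \<and> (\<forall>w c. lookup (part c p) w \<noteq> 0 \<longrightarrow>
      \<not> vanishing w \<and> chain c \<and> length c = n)"
proof
  assume "p \<in> carr (Q n)"
  then obtain J q where J: "finite J" "\<And>j. j \<in> J \<Longrightarrow> q j \<in> piece (Q n) j" "p = (\<Sum>j\<in>J. q j)"
    unfolding carr_def by blast
  have "\<not> vanishing w \<and> chain c \<and> length c = n" if "lookup (part c p) w \<noteq> 0" for w c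
  proof -
    have "(\<Sum>j\<in>J. lookup (part c (q j)) w) \<noteq> 0"
      using that unfolding J(3) part_sum lookup_sum .
    then obtain j where "j \<in> J" "lookup (part c (q j)) w \<noteq> 0"
      by (meson sum.not_neutral_contains_not_neutral)
    then show ?thesis using J(2)[of j] unfolding piece_Q by blast
  qed
  moreover have "coded p"
    unfolding J(3) using J(2) by (intro coded_sum) (simp add: piece_Q)
  ultimately show "coded p \<and> (\<forall>w c. lookup (part c p) w \<noteq> 0 \<longrightarrow>
      \<not> vanishing w \<and> chain c \<and> length c = n)" by blast
next
  assume p: "coded p \<and> (\<forall>w c. lookup (part c p) w \<noteq> 0 \<longrightarrow>
      \<not> vanishing w \<and> chain c \<and> length c = n)"
  define deg where "deg k = (case from_nat k of (w :: 'x list, c) \<Rightarrow> int (length w) + wt c)" for k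
  have deg_code: "deg (code w c) = int (length w) + wt c" for w c
    by (simp add: deg_def code_def)
  let ?t = "\<lambda>k. single k (lookup p k)"
  let ?K = "keys p"
  have "?t k \<in> piece (Q n) (deg k)" if k: "k \<in> ?K" for k
  proof -
    obtain w c where wc: "k = code w c"
      using p k by (auto simp: coded_def in_keys_iff)
    then have "lookup (part c p) w \<noteq> 0"
      using k by (simp add: in_keys_iff lookup_part)
    then show ?thesis
      unfolding wc deg_code using p by (intro single_in_piece_Q) auto
  qed
  then have "\<forall>j\<in>deg ` ?K. (\<Sum>k\<in>{k \<in> ?K. deg k = j}. ?t k) \<in> piece (Q n) j"
    by (intro ballI piece_Q_sum) force
  moreover have "p = (\<Sum>j\<in>deg ` ?K. \<Sum>k\<in>{k \<in> ?K. deg k = j}. ?t k)"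
    using sum.image_gen[of ?K ?t deg] by (simp add: poly_mapping_sum_single)
  ultimately have "finite (deg ` ?K) \<and> (\<forall>j\<in>deg ` ?K. (\<Sum>k\<in>{k \<in> ?K. deg k = j}. ?t k) \<in> piece (Q n) j)
      \<and> p = (\<Sum>j\<in>deg ` ?K. \<Sum>k\<in>{k \<in> ?K. deg k = j}. ?t k)"
    by simp
  then show "p \<in> carr (Q n)"
    unfolding carr_def mem_Collect_eq by (intro exI)
qed

lemma gr_module_Q: "gr_module I (Q n)"
proof (rule gr_moduleI, goal_cases)
  case (1 j)
  show ?case by (rule piece_Q_zero)
next
  case (2 j m m')
  then show ?case by (rule piece_Q_add)
next
  case (3 J q j)
  show ?case
  proof (rule coded_eqI)
    show "coded (q j)" using 3(2,4) by (simp add: piece_Q)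
    fix c
    show "part c (q j) = part c 0"
    proof (rule poly_mapping_eqI, rule ccontr)
      fix w assume "lookup (part c (q j)) w \<noteq> lookup (part c 0) w"
      then have nz: "lookup (part c (q j)) w \<noteq> 0" by simp
      have "lookup (part c (q i)) w = 0" if "i \<in> J" "i \<noteq> j" for i
        using 3(2,4) that nz unfolding piece_Q by metis
      then have "(\<Sum>i\<in>J. lookup (part c (q i)) w) = lookup (part c (q j)) w"
        using 3(1,4) by (simp add: sum.remove)
      moreover have "(\<Sum>i\<in>J. lookup (part c (q i)) w) = 0"
        using 3(3) by (metis part_sum part_zero lookup_sum lookup_zero)
      ultimately show False using nz by simp
    qed
  qed simp
next
  case (4 d a j p)
  have "\<not> vanishing w \<and> chain c \<and> length c = n \<and> int (length w) + wt c = int d + j"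
    if "lookup (nf (a * part c p)) w \<noteq> 0" for w c
  proof -
    have w: "\<not> vanishing w" "w \<in> keys (a * part c p)"
      using that by (auto simp: lookup_nf in_keys_iff split: if_splits)
    then obtain u v where "w = u + v" "u \<in> keys a" "v \<in> keys (part c p)"
      using keys_mult[of a "part c p"] by blast
    then show ?thesis
      using 4 w(1) unfolding piece_Q homog_def by (auto simp: plus_list_def in_keys_iff)
  qed
  then show ?case
    by (simp add: piece_Q part_Q_act coded_Q_act)
next
  case (8 p)
  show ?case
    unfolding act_Q
  proof (rule coded_eqI)
    show "part c (Q_act 1 p) = part c p" for c
      using 8 by (intro poly_mapping_eqI) (auto simp: part_Q_act lookup_nf carr_Q)
  qed (use 8 in \<open>auto simp: coded_Q_act carr_Q\<close>)
qed (auto intro!: coded_eqI simp: coded_Q_act coded_add carr_Q part_Q_act part_add distrib_left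
    distrib_right nf_add nf_mult_nf_right mult.assoc nf_ideal ideal_mult_right)

interpretation Q: gr_module I "Q n" for n
  by (rule gr_module_Q)

lemma Q_act_single:
  assumes "\<not> vanishing (u @ w)"
  shows "Q_act (single u a) (single (code w c) b) = single (code (u @ w) c) (a * b)"
  by (rule coded_eqI)
    (use assms in \<open>auto intro!: poly_mapping_eqI simp: coded_Q_act part_Q_act part_single mult_single plus_list_def
      lookup_nf lookup_single when_def\<close>)

text \<open>The basis elements of degree \<open>j\<close> in \<open>Q n\<close> consist of a chain of length \<open>n\<close>, of which there are finitely many,
and a word of length at most \<open>j\<close>.\<close>

lemma locally_finite_Q: "locally_finite (Q n)"
  unfolding locally_finite_def
proof
  fix j :: int
  let ?W = "{w :: 'x list. length w \<le> nat j}"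
  let ?X = "{(w, c). w \<in> ?W \<and> length c = n \<and> \<not> vanishing w \<and> chain c \<and> int (length w) + wt c = j}"
  let ?b = "\<lambda>(w, c). single (code w c) 1 :: nat \<Rightarrow>\<^sub>0 'k"
  have W: "finite ?W"
    using finite_lists_length_le[of "UNIV :: 'x set" "nat j"] by simp
  have X: "finite ?X"
    by (rule finite_subset[OF _ finite_cartesian_product[OF W finite_chains[of n]]]) auto
  have inj: "inj_on ?b ?X"
    by (rule inj_onI) (auto simp: split_beta, (metis code_eq_iff lookup_single_eq lookup_single_not_eq zero_neq_one)+)
  have sub: "?b ` ?X \<subseteq> piece (Q n) j"
    using single_in_piece_Q by fastforce
  have "\<exists>s. p = (\<Sum>b\<in>?b ` ?X. act (Q n) (scalar (s b)) b)" if p: "p \<in> piece (Q n) j" for p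
  proof -
    define s where "s b = lookup p (case inv_into ?X ?b b of (w, c) \<Rightarrow> code w c)" for b
    have "(\<Sum>b\<in>?b ` ?X. act (Q n) (scalar (s b)) b) = (\<Sum>x\<in>?X. act (Q n) (scalar (s (?b x))) (?b x))"
      using inj by (rule sum.reindex_cong) auto
    also have "\<dots> = (\<Sum>x\<in>?X. case x of (w, c) \<Rightarrow> single (code w c) (lookup p (code w c)))"
    proof (rule sum.cong[OF refl])
      fix x assume x: "x \<in> ?X"
      obtain w c where wc: "x = (w, c)" by force
      have "s (?b x) = lookup p (code w c)"
        unfolding s_def using inv_into_f_f[OF inj x] by (simp only: wc prod.case)
      then show "act (Q n) (scalar (s (?b x))) (?b x)
          = (case x of (w, c) \<Rightarrow> single (code w c) (lookup p (code w c)))"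
        using x Q_act_single[of "[]" w "s (?b x)" c 1] by (simp add: wc scalar_def)
    qed
    also have "\<dots> = p"
    proof (rule poly_mapping_eqI)
      fix k
      let ?t = "\<lambda>x. case x of (w, c) \<Rightarrow> single (code w c) (lookup p (code w c))"
      show "lookup (\<Sum>x\<in>?X. ?t x) k = lookup p k"
      proof (cases "lookup p k = 0")
        case True
        then show ?thesis
          by (auto simp: lookup_sum lookup_single when_def intro!: sum.neutral)
      next
        case False
        then obtain w c where k: "k = code w c"
          using p by (auto simp: piece_Q coded_def)
        have wc: "\<not> vanishing w" "chain c" "length c = n" "int (length w) + wt c = j"
          using False p unfolding piece_Q k lookup_part by blast+
        then have "length w \<le> nat j" by (simp add: wt_def)
        then have x: "(w, c) \<in> ?X"
          using wc by auto
        have "lookup (\<Sum>x\<in>?X. ?t x) k = (\<Sum>x\<in>?X. if x = (w, c) then lookup p k else 0)"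
          unfolding lookup_sum k by (rule sum.cong[OF refl]) (auto simp: lookup_single when_def split: if_splits)
        then show ?thesis
          using X x by simp
      qed
    qed
    finally have "p = (\<Sum>b\<in>?b ` ?X. act (Q n) (scalar (s b)) b)" by (rule sym)
    then show ?thesis by (rule exI[of _ s])
  qed
  then show "\<exists>B. finite B \<and> B \<subseteq> piece (Q n) j \<and> (\<forall>p\<in>piece (Q n) j. \<exists>s. p = (\<Sum>b\<in>B. act (Q n) (scalar (s b)) b))"
    by (intro exI[of _ "?b ` ?X"] conjI ballI finite_imageI X sub)
qed

definition gen :: "'x list list \<Rightarrow> (nat \<Rightarrow>\<^sub>0 'k)"
  where "gen c = single (code [] c) 1"

lemma gen_in_piece:
  "chain c \<Longrightarrow> length c = n \<Longrightarrow> gen c \<in> piece (Q n) (wt c)"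
  using single_in_piece_Q[of "[]" c n 1] not_vanishing_short[of "[]"] by (simp add: gen_def)

lemma gen_in_carr: "chain c \<Longrightarrow> length c = n \<Longrightarrow> gen c \<in> carr (Q n)"
  using gen_in_piece by (rule piece_subset_carr)

lemma supp_chain:
  "p \<in> carr (Q n) \<Longrightarrow> c \<in> supp p \<Longrightarrow> chain c \<and> length c = n"
proof -
  assume p: "p \<in> carr (Q n)" and "c \<in> supp p"
  then obtain w where "lookup (part c p) w \<noteq> 0"
    unfolding supp_def using poly_mapping_eqI[of "part c p" 0] by auto
  then show "chain c \<and> length c = n"
    using p unfolding carr_Q by blast
qed

lemma part_gen: "part c (gen c') = (if c = c' then 1 else 0)"
  by (simp add: gen_def part_single flip: zero_list_def)

lemma nf_part: "p \<in> carr (Q n) \<Longrightarrow> nf (part c p) = part c p"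
  by (intro poly_mapping_eqI) (auto simp: lookup_nf carr_Q)

lemma Q_expand:
  assumes "p \<in> carr (Q n)"
  shows "p = (\<Sum>c\<in>supp p. Q_act (part c p) (gen c))"
proof (rule coded_eqI)
  fix c
  have "part c (\<Sum>c\<in>supp p. Q_act (part c p) (gen c)) = (\<Sum>c'\<in>supp p. if c = c' then part c p else 0)"
    unfolding part_sum by (intro sum.cong) (auto simp: part_Q_act part_gen nf_part[OF assms])
  then show "part c p = part c (\<Sum>c\<in>supp p. Q_act (part c p) (gen c))"
    by (simp add: supp_def[symmetric]) (simp add: supp_def)
qed (use assms in \<open>auto simp: carr_Q coded_Q_act intro!: coded_sum\<close>)

text \<open>A homomorphism from a free module is determined by arbitrary images \<open>m c\<close> of the generators, of the right
degrees. For each generator a homogeneous preimage of its image in \<open>N\<close> is chosen.\<close>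

lemma projective_Q: "projective I (Q n)"
  unfolding projective_def
proof (intro conjI allI impI)
  show "graded_module I (Q n)"
    using gr_module_Q[of n] by (simp add: gr_module_def)
  show "locally_finite (Q n)"
    by (rule locally_finite_Q)
  fix M N :: "('x, 'k, nat \<Rightarrow>\<^sub>0 'k) gmod" and g f
  assume *: "graded_module I M \<and> locally_finite M \<and> graded_module I N \<and> locally_finite N \<and>
    ghom M N 0 g \<and> g ` carr M = carr N \<and> ghom (Q n) N 0 f"
  interpret g: gr_hom I M N 0 g
    using * by (simp add: gr_hom_def gr_hom_axioms_def gr_module_def)
  interpret f: gr_hom I "Q n" N 0 f
    using * gr_module_Q by (simp add: gr_hom_def gr_hom_axioms_def gr_module_def)
  have "\<exists>m. m \<in> piece M (wt c) \<and> g m = f (gen c)" if "chain c \<and> length c = n" for c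
  proof -
    have fc: "f (gen c) \<in> piece N (wt c)"
      using ghom_piece[OF f.hom gen_in_piece[of c n]] that by simp
    then obtain m where "m \<in> carr M" "f (gen c) = g m"
      using * piece_subset_carr[OF fc] by blast
    then show ?thesis
      using g.homogeneous_preimage[of m "wt c"] fc by metis
  qed
  then obtain m where m: "\<And>c. chain c \<and> length c = n \<Longrightarrow> m c \<in> piece M (wt c) \<and> g (m c) = f (gen c)"
    by metis
  let ?C = "{c. chain c \<and> length c = n}"
  define h where "h p = (\<Sum>c\<in>?C. act M (part c p) (m c))" for p
  have mc: "m c \<in> carr M" if "c \<in> ?C" for c
    using m that piece_subset_carr by blast
  have "ghom (Q n) M 0 h"
    unfolding ghom_def
  proof (intro conjI allI ballI image_subsetI)
    fix p q
    show "h (p + q) = h p + h q"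
      unfolding h_def part_add sum.distrib[symmetric]
      by (rule sum.cong[OF refl]) (simp add: g.source.act_add_left mc)
  next
    fix a p
    \<comment> \<open>normal forms do not matter, because the ideal acts as 0 on M\<close>
    have "act M (nf x) (m c) = act M x (m c)" if "c \<in> ?C" for x c
      using g.source.act_add_left[OF mc[OF that], of x "nf x - x"]
        g.source.act_ideal[OF nf_diff_ideal mc[OF that], of x] by simp
    then have "h (act (Q n) a p) = (\<Sum>c\<in>?C. act M a (act M (part c p) (m c)))"
      unfolding h_def act_Q part_Q_act by (intro sum.cong) (auto simp: g.source.act_mult mc)
    then show "h (act (Q n) a p) = act M a (h p)"
      unfolding h_def using mc by (subst g.source.act_sum_right) (auto intro: g.source.act_carr)
  next
    fix j p assume p: "p \<in> piece (Q n) j"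
    show "h p \<in> piece M (j + 0)"
      unfolding h_def
    proof (rule g.source.piece_sum)
      fix c assume c: "c \<in> ?C"
      show "act M (part c p) (m c) \<in> piece M (j + 0)"
      proof (cases "part c p = 0")
        case True
        then show ?thesis using c mc by (simp add: g.source.act_zero_left g.source.piece_zero)
      next
        case False
        then obtain w where "lookup (part c p) w \<noteq> 0"
          using poly_mapping_eqI[of "part c p" 0] by auto
        then have "int (length w) + wt c = j" using p unfolding piece_Q by blast
        then have j: "int (length w) = j - wt c" by simp
        have "part c p \<in> homog (length w)"
          unfolding homog_def using p j by (auto simp: piece_Q in_keys_iff) (metis add_diff_cancel_right' of_nat_eq_iff)
        from g.source.act_piece[OF this] m c j show ?thesis by fastforce
      qed
    qed
  qed
  moreover have "g (h p) = f p" if p: "p \<in> carr (Q n)" for p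
  proof -
    have gc: "gen c \<in> carr (Q n)" if "c \<in> ?C" for c
      using gen_in_carr that by blast
    have sub: "supp p \<subseteq> ?C"
      using supp_chain[OF p] by blast
    have "g (h p) = (\<Sum>c\<in>?C. g (act M (part c p) (m c)))"
      unfolding h_def using mc by (intro g.sum) (auto intro: g.source.act_carr)
    also have "\<dots> = (\<Sum>c\<in>?C. f (Q_act (part c p) (gen c)))"
      using mc m gc by (intro sum.cong refl) (auto simp: ghom_act[OF g.hom] ghom_act[OF f.hom, simplified])
    also have "\<dots> = (\<Sum>c\<in>supp p. f (Q_act (part c p) (gen c)))"
    proof (rule sum.mono_neutral_right[OF finite_chains sub])
      show "\<forall>c\<in>?C - supp p. f (Q_act (part c p) (gen c)) = 0"
        using gc Q.act_zero_left[of _ n] by (auto simp: supp_def ghom_zero[OF f.hom])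
    qed
    also have "\<dots> = f (\<Sum>c\<in>supp p. Q_act (part c p) (gen c))"
      using gc sub Q.act_carr[of _ n] by (intro f.sum[symmetric]) auto
    finally show ?thesis
      using Q_expand[OF p] by simp
  qed
  ultimately show "\<exists>h. ghom (Q n) M 0 h \<and> (\<forall>p\<in>carr (Q n). g (h p) = f p)"
    by blast
qed

text \<open>The differential sends the generator \<open>z # t\<close> to \<open>z\<close> times the generator \<open>t\<close>. It is linear over the
algebra, which acts from the left, hence it multiplies the coefficient of \<open>z # t\<close> by \<open>z\<close> from the right.\<close>

definition Q_d :: "(nat \<Rightarrow>\<^sub>0 'k) \<Rightarrow> (nat \<Rightarrow>\<^sub>0 'k)"
  where "Q_d p = assemble (tl ` supp p) (\<lambda>t. \<Sum>z\<in>{z. chain (z # t)}. nf (part (z # t) p * mon z))"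

definition Q_eps :: "(nat \<Rightarrow>\<^sub>0 'k) \<Rightarrow> 'k"
  where "Q_eps p = lookup (part [] p) []"

lemma part_Q_d: "part t (Q_d p) = (\<Sum>z\<in>{z. chain (z # t)}. nf (part (z # t) p * mon z))"
proof -
  have "(\<Sum>z\<in>{z. chain (z # t)}. nf (part (z # t) p * mon z)) = 0" if "t \<notin> tl ` supp p"
  proof (rule sum.neutral, rule ballI)
    fix z
    have "z # t \<notin> supp p" using that by force
    then show "nf (part (z # t) p * mon z) = 0" by (simp add: supp_def)
  qed
  then show ?thesis
    by (simp add: Q_d_def part_assemble)
qed

lemma coded_Q_d: "coded (Q_d p)"
  unfolding Q_d_def by (rule coded_assemble)

lemma Q_d_add: "Q_d (p + q) = Q_d p + Q_d q"
  by (rule coded_eqI)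
    (auto simp: coded_Q_d coded_add part_Q_d part_add distrib_right nf_add sum.distrib)

lemma Q_d_zero: "Q_d 0 = 0"
  by (simp add: Q_d_def supp_def assemble_def)

lemma Q_d_sum: "Q_d (\<Sum>j\<in>J. p j) = (\<Sum>j\<in>J. Q_d (p j))"
  by (induction J rule: infinite_finite_induct) (auto simp: Q_d_add Q_d_zero)

lemma Q_d_act: "Q_d (Q_act a p) = Q_act a (Q_d p)"
  by (rule coded_eqI)
    (auto simp: coded_Q_d coded_Q_act part_Q_d part_Q_act nf_mult_nf_left nf_mult_nf_right
      sum_distrib_left nf_sum mult.assoc)

lemma ghom_Q_d: "ghom (Q (Suc n)) (Q n) 0 Q_d"
  unfolding ghom_def
proof (intro conjI allI ballI image_subsetI)
  fix j p assume p: "p \<in> piece (Q (Suc n)) j"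
  have "\<not> vanishing w \<and> chain t \<and> length t = n \<and> int (length w) + wt t = j"
    if nz: "lookup (part t (Q_d p)) w \<noteq> 0" for t w
  proof -
    have "(\<Sum>z\<in>{z. chain (z # t)}. lookup (nf (part (z # t) p * mon z)) w) \<noteq> 0"
      using nz unfolding part_Q_d lookup_sum .
    then obtain z where z: "chain (z # t)" "lookup (nf (part (z # t) p * mon z)) w \<noteq> 0"
      by (metis (mono_tags, lifting) mem_Collect_eq sum.not_neutral_contains_not_neutral)
    then have w: "\<not> vanishing w" "lookup (part (z # t) p * mon z) w \<noteq> 0"
      by (auto simp: lookup_nf split: if_splits)
    obtain v where v: "w = v @ z" "lookup (part (z # t) p) v \<noteq> 0"
      by (rule lookup_mult_mon_neq_0[OF w(2)])
    then have "chain (z # t) \<and> length (z # t) = Suc n \<and> int (length v) + wt (z # t) = j"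
      using p unfolding piece_Q by blast
    then show ?thesis
      using w(1) chain_tl v(1) by (auto simp: wt_def)
  qed
  then show "Q_d p \<in> piece (Q n) (j + 0)"
    by (simp add: piece_Q coded_Q_d)
qed (simp_all add: Q_d_add Q_d_act)

text \<open>Different generators do not interfere: the word \<open>w z\<close> times the generator \<open>t\<close> can only come from \<open>w\<close> times the
generator \<open>z # t\<close>, because no other entry that extends \<open>t\<close> is a right end of the same word. Exactness and the
recursion for lifts both rest on this.\<close>

lemma lookup_Q_d:
  assumes "chain (z # t)" "\<not> vanishing (w @ z)"
  shows "lookup (part t (Q_d p)) (w @ z) = lookup (part (z # t) p) w"
proof -
  have "lookup (part t (Q_d p)) (w @ z)
      = (\<Sum>z'\<in>{z. chain (z # t)}. if z' = z then lookup (part (z # t) p) w else 0)"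
    unfolding part_Q_d lookup_sum
  proof (rule sum.cong[OF refl])
    fix z' assume z': "z' \<in> {z. chain (z # t)}"
    show "lookup (nf (part (z' # t) p * mon z')) (w @ z)
        = (if z' = z then lookup (part (z # t) p) w else 0)"
    proof (cases "z' = z")
      case True
      then show ?thesis using assms(2) by (simp add: lookup_nf lookup_mult_mon_append)
    next
      case False
      have "lookup (part (z' # t) p * mon z') (w @ z) = 0"
      proof (rule ccontr)
        assume "lookup (part (z' # t) p * mon z') (w @ z) \<noteq> 0"
        then obtain v where "w @ z = v @ z'" by (rule lookup_mult_mon_neq_0)
        then show False using chain_suffix_unique[of z t z' w v] assms(1) z' False by simp
      qed
      then show ?thesis using False by (simp add: lookup_nf)
    qed
  qed
  also have "\<dots> = lookup (part (z # t) p) w"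
    using assms(1) by (simp add: finite_extensions)
  finally show ?thesis .
qed

text \<open>The minimality of the resolution: boundaries have no scalar coefficients.\<close>

lemma lookup_Q_d_Nil: "lookup (part t (Q_d p)) [] = 0"
proof -
  have "lookup (part (z # t) p * mon z) [] = 0" if "chain (z # t)" for z
  proof (rule ccontr)
    assume "lookup (part (z # t) p * mon z) [] \<noteq> 0"
    then obtain v where "[] = v @ z" by (rule lookup_mult_mon_neq_0)
    then show False using chain_hd[OF that] by simp
  qed
  then show ?thesis
    unfolding part_Q_d lookup_sum by (intro sum.neutral) (simp add: lookup_nf)
qed

lemma Q_d_single:
  assumes "chain (y # c)" "\<not> vanishing (v @ y)"
  shows "Q_d (single (code v (y # c)) a) = single (code (v @ y) c) a"
proof (rule coded_eqI)
  fix t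
  have "part t (Q_d (single (code v (y # c)) a))
      = (\<Sum>z\<in>{z. chain (z # t)}. if z = y then (if t = c then single (v @ y) a else 0) else 0)"
    unfolding part_Q_d part_single
  proof (rule sum.cong[OF refl])
    fix z
    have "nf (single v a * mon y) = single (v @ y) a"
      using assms(2) by (intro poly_mapping_eqI)
        (auto simp: mon_def mult_single plus_list_def lookup_nf lookup_single when_def)
    then show "nf ((if z # t = y # c then single v a else 0) * mon z)
        = (if z = y then (if t = c then single (v @ y) a else 0) else 0)"
      by simp
  qed
  then show "part t (Q_d (single (code v (y # c)) a)) = part t (single (code (v @ y) c) a)"
    using assms(1) by (simp add: finite_extensions part_single)
qed (simp_all add: coded_Q_d)

lemma Q_d_gen: "chain (y # c) \<Longrightarrow> Q_d (gen (y # c)) = Q_act (mon y) (gen c)"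
  using Q_d_single[of y c "[]" 1] chain_hd[of y c] Q_act_single[of y "[]" 1 c 1]
  by (simp add: gen_def mon_def)

lemma Q_d_Q_d: "Q_d (Q_d p) = 0"
proof (rule coded_eqI)
  fix t
  have "nf (part (z # t) (Q_d p) * mon z) = 0" if "chain (z # t)" for z
  proof -
    have zero: "nf (nf (part (y # z # t) p * mon y) * mon z) = 0" if "chain (y # z # t)" for y
    proof -
      have "mon (y @ z) \<in> I"
        using that by (simp add: mon_in_ideal_iff min_ann_def)
      then have "part (y # z # t) p * mon y * mon z \<in> I"
        using ideal_mult_left by (simp add: mon_append mult.assoc)
      then show ?thesis
        by (simp add: nf_mult_nf_left nf_ideal)
    qed
    show ?thesis
      unfolding part_Q_d sum_distrib_right nf_sum by (rule sum.neutral) (simp add: zero)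
  qed
  then show "part t (Q_d (Q_d p)) = part t 0"
    unfolding part_Q_d[of t "Q_d p"] by simp
qed (simp_all add: coded_Q_d)

text \<open>Boundaries are spanned by basis elements: if a word \<open>w\<close> annihilates the first entry of \<open>c\<close>, then
\<open>w = v y\<close> where \<open>y # c\<close> is a chain, and \<open>w\<close> times the generator \<open>c\<close> is the boundary of \<open>v\<close> times the
generator \<open>y # c\<close>.\<close>

lemma in_image_Q_d:
  assumes p: "p \<in> carr (Q n)"
    and van: "\<And>w c. lookup (part c p) w \<noteq> 0 \<Longrightarrow> if c = [] then w \<noteq> [] else vanishing (w @ hd c)"
  shows "p \<in> Q_d ` carr (Q (Suc n))"
proof -
  let ?t = "\<lambda>k. single k (lookup p k)"
  have "\<exists>q. q \<in> carr (Q (Suc n)) \<and> Q_d q = ?t k" if key: "k \<in> keys p" for k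
  proof -
    obtain w c where k: "k = code w c"
      using p key by (auto simp: carr_Q coded_def in_keys_iff)
    then have nz: "lookup (part c p) w \<noteq> 0"
      using key by (simp add: lookup_part in_keys_iff)
    then have wc: "\<not> vanishing w" "chain c" "length c = n"
      using p unfolding carr_Q by blast+
    obtain v y where vy: "w = v @ y" "chain (y # c)"
      using chain_extension[OF wc(2,1) van[OF nz]] by blast
    have "\<not> vanishing v"
      using wc(1) vanishing_mono[of v w] vy(1) by auto
    then have "single (code v (y # c)) (lookup p k) \<in> carr (Q (Suc n))"
      using single_in_piece_Q[of v "y # c" "Suc n"] vy(2) wc(3) piece_subset_carr by auto
    then show ?thesis
      using Q_d_single[OF vy(2)] wc(1) k vy(1) by blast
  qed
  then obtain q where q: "\<And>k. k \<in> keys p \<Longrightarrow> q k \<in> carr (Q (Suc n)) \<and> Q_d (q k) = ?t k"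
    by metis
  have "p = Q_d (\<Sum>k\<in>keys p. q k)"
    using q by (simp add: Q_d_sum poly_mapping_sum_single)
  moreover have "(\<Sum>k\<in>keys p. q k) \<in> carr (Q (Suc n))"
    using q by (intro Q.carr_sum) blast
  ultimately show ?thesis by blast
qed

lemma augmentation_ideal: "a \<in> I \<Longrightarrow> lookup a [] = 0"
  using ideal_keys_vanish[of a "[]"] not_vanishing_short[of "[]"] by (auto simp: in_keys_iff)

definition dual :: "'x list list \<Rightarrow> (nat \<Rightarrow>\<^sub>0 'k) \<Rightarrow> 'k"
  where "dual c p = lookup (part c p) []"

lemma ghom_dual: "ghom (Q n) trivial_module (- wt c) (dual c)"
  unfolding ghom_def
proof (intro conjI allI ballI image_subsetI)
  fix a p
  show "dual c (act (Q n) a p) = act trivial_module a (dual c p)"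
    using not_vanishing_short[of "[]"]
    by (simp add: dual_def part_Q_act lookup_nf lookup_mult_Nil act_trivial_module)
next
  fix j p assume p: "p \<in> piece (Q n) j"
  have "j = wt c" if "dual c p \<noteq> 0"
    using p that unfolding piece_Q dual_def by fastforce
  then show "dual c p \<in> piece trivial_module (j + - wt c)"
    by (auto simp: piece_trivial_module)
qed (simp add: dual_def part_add lookup_add)

lemma ghom_Q_eps: "ghom (Q n) trivial_module 0 Q_eps"
  using ghom_dual[of n "[]"] by (simp add: Q_eps_def[abs_def] dual_def[abs_def] wt_def)

text \<open>By \<open>lookup_Q_d\<close>, all words that occur in the coefficients of a cycle annihilate the first entry of their
chain, so \<open>in_image_Q_d\<close> applies.\<close>

lemma resolution_Q: "projective_resolution I Q (\<lambda>_. Q_d) Q_eps"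
  unfolding projective_resolution_def
proof (intro conjI allI)
  have Q_d_carr: "Q_d p \<in> carr (Q n)" if "p \<in> carr (Q (Suc n))" for p n
    using gr_hom.carr[of I "Q (Suc n)" "Q n" 0 Q_d p] that gr_module_Q ghom_Q_d
    by (simp add: gr_hom_def gr_hom_axioms_def)
  show "Q_eps ` carr (Q 0) = UNIV"
  proof -
    have "x \<in> Q_eps ` carr (Q 0)" for x
      using single_in_piece_Q[of "[]" "[]" 0 x] not_vanishing_short[of "[]"]
      by (intro image_eqI[of _ _ "single (code [] []) x"])
        (auto simp: Q_eps_def part_single intro: piece_subset_carr)
    then show ?thesis by auto
  qed
  show "{p \<in> carr (Q 0). Q_eps p = 0} = Q_d ` carr (Q (Suc 0))"
  proof (intro equalityI subsetI)
    fix p assume "p \<in> {p \<in> carr (Q 0). Q_eps p = 0}"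
    then show "p \<in> Q_d ` carr (Q (Suc 0))"
      by (intro in_image_Q_d) (auto simp: carr_Q Q_eps_def split: if_splits)
  qed (auto intro: Q_d_carr simp: Q_eps_def lookup_Q_d_Nil)
  show "{p \<in> carr (Q (Suc n)). Q_d p = 0} = Q_d ` carr (Q (Suc (Suc n)))" for n
  proof (intro equalityI subsetI)
    fix p assume p: "p \<in> {p \<in> carr (Q (Suc n)). Q_d p = 0}"
    show "p \<in> Q_d ` carr (Q (Suc (Suc n)))"
    proof (rule in_image_Q_d)
      show "p \<in> carr (Q (Suc n))" using p by simp
      fix w c assume nz: "lookup (part c p) w \<noteq> 0"
      then have c: "chain c \<and> length c = Suc n"
        using p by (auto simp: carr_Q)
      then obtain z t where zt: "c = z # t" by (cases c) auto
      have "vanishing (w @ z)"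
      proof (rule ccontr)
        assume "\<not> vanishing (w @ z)"
        then show False
          using lookup_Q_d[of z t w p] c zt nz p by simp
      qed
      then show "if c = [] then w \<noteq> [] else vanishing (w @ hd c)"
        by (simp add: zt)
    qed
  qed (auto intro: Q_d_carr simp: Q_d_Q_d)
qed (auto simp: projective_Q ghom_Q_d ghom_Q_eps)

section \<open>Yoneda products\<close>

lemma dual_gen: "dual c (gen c') = (if c = c' then 1 else 0)"
proof -
  have "lookup (1 :: ('x, 'k) free_alg) [] = 1"
    by (simp add: lookup_one zero_list_def)
  then show ?thesis by (simp add: dual_def part_gen)
qed

lemma dual_Q_d: "dual c (Q_d p) = 0"
  by (simp add: dual_def lookup_Q_d_Nil)

lemma cocycle_dual: "ext_cocycle Q (\<lambda>_. Q_d) n (wt c) (dual c)"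
  by (simp add: ext_cocycle_def ghom_dual dual_Q_d)

lemma gr_hom_trivial:
  "ghom (Q n) trivial_module m f \<Longrightarrow> gr_hom I (Q n) trivial_module m f"
  using gr_module_Q graded_trivial_module[OF augmentation_ideal]
  by (simp add: gr_hom_def gr_hom_axioms_def)

text \<open>Homomorphisms to the trivial module kill all words of positive length, so they are linear combinations of the
functionals dual to the generators.\<close>

lemma functional_expand:
  assumes f: "ghom (Q n) trivial_module m f" and p: "p \<in> carr (Q n)"
  shows "f p = (\<Sum>c\<in>{c. chain c \<and> length c = n}. dual c p * f (gen c))"
proof -
  interpret f: gr_hom I "Q n" trivial_module m f
    using f by (rule gr_hom_trivial)
  have gc: "gen c \<in> carr (Q n)" if "c \<in> supp p" for c
    using supp_chain[OF p that] by (simp add: gen_in_carr)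
  have "f p = (\<Sum>c\<in>supp p. f (Q_act (part c p) (gen c)))"
    using Q.act_carr[of _ n] gc by (subst Q_expand[OF p], subst f.sum) auto
  also have "\<dots> = (\<Sum>c\<in>supp p. dual c p * f (gen c))"
    using gc by (intro sum.cong refl)
      (simp add: ghom_act[OF f, simplified] act_trivial_module dual_def)
  also have "\<dots> = (\<Sum>c\<in>{c. chain c \<and> length c = n}. dual c p * f (gen c))"
    using supp_chain[OF p] by (intro sum.mono_neutral_left finite_chains) (auto simp: supp_def dual_def)
  finally show ?thesis .
qed

lemma functional_eqI:
  assumes "ghom (Q n) trivial_module m f" "ghom (Q n) trivial_module m' g"
    and "\<And>c. chain c \<Longrightarrow> length c = n \<Longrightarrow> f (gen c) = g (gen c)" "p \<in> carr (Q n)"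
  shows "f p = g p"
  using functional_expand[OF assms(1,4)] functional_expand[OF assms(2,4)] assms(3)
  by (auto intro: sum.cong)

lemma functional_Q_d:
  assumes "ghom (Q n) trivial_module m f" "p \<in> carr (Q (Suc n))"
  shows "f (Q_d p) = 0"
proof -
  have "Q_d p \<in> carr (Q n)"
    using gr_hom.carr[of I "Q (Suc n)" "Q n" 0 Q_d p] assms(2) gr_module_Q ghom_Q_d
    by (simp add: gr_hom_def gr_hom_axioms_def)
  then show ?thesis
    using functional_expand[OF assms(1)] by (simp add: dual_Q_d)
qed

text \<open>As the resolution is minimal, cohomologous cocycles on it are equal.\<close>

lemma coboundary_zero:
  assumes "ext_coboundary Q (\<lambda>_. Q_d) n m f" "p \<in> carr (Q n)"
  shows "f p = 0"
proof (cases n)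
  case 0
  then show ?thesis using assms by (simp add: ext_coboundary_def)
next
  case (Suc k)
  then obtain g where g: "ghom (Q k) trivial_module (- m) g" "\<forall>p\<in>carr (Q (Suc k)). f p = g (Q_d p)"
    using assms(1) by (auto simp: ext_coboundary_def)
  then show ?thesis using functional_Q_d[OF g(1)] assms(2) Suc by simp
qed

lemma lift_ghom:
  "yoneda_lift P d \<epsilon> n m f F \<Longrightarrow> ghom (P (n + i)) (P i) (- m) (F i)"
  by (simp add: yoneda_lift_def)

text \<open>The recursion for lifts. By \<open>lookup_Q_d\<close>, the coefficient of \<open>w\<close> at \<open>z # t\<close> can be read off at \<open>w z\<close> after
applying the differential. The lift commutes with the differential, which turns the generator
\<open>y # q\<close> into \<open>y\<close> times the generator \<open>q\<close>, and the lift commutes with the action of \<open>y\<close>.\<close>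

lemma lift_coefficient:
  assumes F: "yoneda_lift Q (\<lambda>_. Q_d) Q_eps n m f F"
    and yq: "chain (y # q)" "length q = n + i"
    and zt: "chain (z # t)" "\<not> vanishing (w @ z)"
  shows "w @ z = y @ v \<Longrightarrow> lookup (part (z # t) (F (Suc i) (gen (y # q)))) w
      = lookup (part t (F i (gen q))) v"
    and "lookup (part (z # t) (F (Suc i) (gen (y # q)))) w \<noteq> 0 \<Longrightarrow> \<exists>v. w @ z = y @ v"
proof -
  have F1: "ghom (Q (n + i)) (Q i) (- m) (F i)"
    "p \<in> carr (Q (n + Suc i)) \<Longrightarrow> Q_d (F (Suc i) p) = F i (Q_d p)" for p
    using F by (simp_all add: yoneda_lift_def)
  have q: "chain q" using chain_tl yq(1) .
  have "lookup (part (z # t) (F (Suc i) (gen (y # q)))) w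
      = lookup (part t (Q_d (F (Suc i) (gen (y # q))))) (w @ z)"
    using lookup_Q_d[OF zt] by simp
  also have "Q_d (F (Suc i) (gen (y # q))) = F i (Q_act (mon y) (gen q))"
    using F1(2)[of "gen (y # q)"] gen_in_carr[OF yq(1)] yq(2) Q_d_gen[OF yq(1)] by simp
  also have "\<dots> = Q_act (mon y) (F i (gen q))"
    using ghom_act[OF F1(1) gen_in_carr[OF q yq(2)], of "mon y"] by simp
  also have "lookup (part t (Q_act (mon y) (F i (gen q)))) (w @ z)
      = lookup (mon y * part t (F i (gen q))) (w @ z)"
    using zt(2) by (simp add: part_Q_act lookup_nf)
  finally have eq: "lookup (part (z # t) (F (Suc i) (gen (y # q)))) w
      = lookup (mon y * part t (F i (gen q))) (w @ z)" .
  show "w @ z = y @ v \<Longrightarrow> lookup (part (z # t) (F (Suc i) (gen (y # q)))) w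
      = lookup (part t (F i (gen q))) v"
    unfolding eq by (simp add: lookup_mon_mult_append)
  show "lookup (part (z # t) (F (Suc i) (gen (y # q)))) w \<noteq> 0 \<Longrightarrow> \<exists>v. w @ z = y @ v"
    unfolding eq by (elim lookup_mon_mult_neq_0) blast
qed

lemma lift_coefficient_0:
  assumes F: "yoneda_lift Q (\<lambda>_. Q_d) Q_eps n m f F" and q: "chain q" "length q = n"
  shows "lookup (part [] (F 0 (gen q))) [] = f (gen q)"
  using F gen_in_carr[OF q] by (simp add: yoneda_lift_def Q_eps_def)

text \<open>The chains that violate the condition of the theorem at their first two entries. These suffice, since every
tail of a chain is a chain.\<close>

definition obstructing :: "'x list list \<Rightarrow> bool"
  where "obstructing c \<longleftrightarrow> (\<exists>a b t. c = a # b # t \<and> length a \<ge> 2 \<and> a @ b \<notin> R)"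

text \<open>The relation from \<open>min_ann_generator\<close> reaches into \<open>z\<close>, so it exhausts \<open>z\<close> if \<open>z\<close> is a letter. Hence the
chains of length 2 spell relations.\<close>

lemma min_ann_letter: "min_ann y z \<Longrightarrow> length z = 1 \<Longrightarrow> y @ z \<in> R"
proof -
  assume y: "min_ann y z" and z: "length z = 1"
  then obtain b v where b: "b \<noteq> []" "y @ b \<in> R" "z = b @ v"
    using min_ann_generator[OF y not_vanishing_short] by auto
  then have "v = []" using z by (cases b) auto
  then show "y @ z \<in> R" using b by simp
qed

lemma obstructing_length:
  "chain c \<Longrightarrow> obstructing c \<Longrightarrow> length c \<ge> 3"
proof -
  assume c: "chain c" and "obstructing c"
  then obtain a b t where abt: "c = a # b # t" "a @ b \<notin> R"
    unfolding obstructing_def by blast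
  have "t \<noteq> []"
    using c abt min_ann_letter[of a b] by auto
  then show ?thesis using abt(1) by (cases t) auto
qed

text \<open>Being obstructing propagates through lifts. If \<open>p = y # z # r\<close> has a nonzero scalar coefficient in the image of
\<open>a # b # q\<close>, two steps of the recursion give \<open>y = a s\<close> and then \<open>s z = b u\<close>, so that \<open>y z = a b u\<close>.
If this were a relation, it would equal the relation contained in \<open>a b\<close>, hence \<open>a b\<close>.\<close>

lemma obstructing_lift:
  assumes F: "yoneda_lift Q (\<lambda>_. Q_d) Q_eps n m f F"
    and c: "chain c" "obstructing c" "length c = n + Suc i"
    and p: "chain p" "length p = Suc i"
    and nz: "dual p (F (Suc i) (gen c)) \<noteq> 0"
  shows "obstructing p"
proof -
  obtain a b q where abq: "c = a # b # q" "length a \<ge> 2" "a @ b \<notin> R"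
    using c(2) unfolding obstructing_def by blast
  obtain y t where yt: "p = y # t" using p(2) by (cases p) auto
  have y: "\<not> vanishing y" using chain_hd p(1) yt by blast
  have nz1: "lookup (part (y # t) (F (Suc i) (gen (a # b # q)))) [] \<noteq> 0"
    using nz by (simp add: dual_def abq(1) yt)
  have len: "length (b # q) = n + i" using c(3) abq(1) by simp
  have ch: "chain (a # b # q)" "chain (y # t)" using c(1) abq(1) p(1) yt by simp_all
  obtain s where s: "y = a @ s"
    using lift_coefficient(2)[OF F ch(1) len ch(2) _ nz1] y by auto
  have nz2: "lookup (part t (F i (gen (b # q)))) s \<noteq> 0"
    using lift_coefficient(1)[OF F ch(1) len ch(2), of "[]" s] y s nz1 by simp
  have "t \<noteq> []"
  proof
    assume "t = []"
    then have "length y = 1" using ch(2) by simp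
    then show False using s abq(2) by simp
  qed
  then obtain z r where zr: "t = z # r" by (cases t) auto
  have yz: "min_ann y z" using ch(2) zr by simp
  have "strict_suffix s y"
    using s abq(2) by (auto simp: strict_suffix_def suffix_def)
  then have sz: "\<not> vanishing (s @ z)"
    using yz by (simp add: min_ann_def)
  obtain k where k: "i = Suc k" using p(2) yt zr by (cases i) auto
  obtain u where u: "s @ z = b @ u"
    using lift_coefficient(2)[OF F _ _ _ sz, of b q k r] nz2 ch len zr k by auto
  have "y @ z \<notin> R"
  proof
    assume R: "y @ z \<in> R"
    have yzu: "y @ z = (a @ b) @ u" using s u by simp
    have "vanishing (a @ b)" using ch(1) by (simp add: min_ann_def)
    then obtain r' where r': "r' \<in> R" "sublist r' (a @ b)" by (auto simp: vanishing_def)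
    then have "sublist r' (y @ z)"
      unfolding yzu by (meson sublist_append_rightI sublist_order.order_trans)
    then have "r' = y @ z" using antichain r'(1) R by blast
    then have "u = []" using sublist_length_le[OF r'(2)] yzu by simp
    then show False using R yzu abq(3) by simp
  qed
  then show ?thesis
    using s abq(2) yt zr by (auto simp: obstructing_def)
qed

text \<open>The subalgebra generated in degrees 1 and 2 lies in the common kernel of the evaluations at obstructing
chains. The homomorphism property is carried along because the expansion of \<open>g\<close> in the product case needs it.\<close>

lemma generated_vanishes_on_obstructing:
  assumes "yoneda_generated Q (\<lambda>_. Q_d) Q_eps {1, 2} n m f"
  shows "ghom (Q n) trivial_module (- m) f \<and> (\<forall>c. chain c \<longrightarrow> length c = n \<longrightarrow> obstructing c \<longrightarrow> f (gen c) = 0)"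
  using assms
proof induction
  case unit
  then show ?case using ghom_Q_eps[of 0] obstructing_length by fastforce
next
  case (gen n m f)
  then show ?case using obstructing_length by (fastforce simp: ext_cocycle_def)
next
  case (zero n m)
  then show ?case by (simp add: ghom_def act_trivial_module piece_trivial_module image_subset_iff)
next
  case (add n m f g)
  then show ?case
    by (auto simp: ghom_def act_trivial_module piece_trivial_module algebra_simps image_subset_iff split: if_splits)
      (metis add.right_neutral)
next
  case (scale n m f c)
  then show ?case
    by (auto simp: ghom_def act_trivial_module piece_trivial_module algebra_simps image_subset_iff split: if_splits)
next
  case (prod n m f n' m' g F)
  have Fh: "ghom (Q (n + n')) (Q n') (- m) (F n')"
    using prod.hyps by (simp add: yoneda_lift_def)
  have g: "ghom (Q n') trivial_module (- m') g" using prod.IH by simp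
  have "ghom (Q (n + n')) trivial_module (- m + - m') (\<lambda>p. g (F n' p))"
    by (rule ghom_compose[OF gr_module_Q gr_module_Q Fh g])
  moreover have "g (F n' (gen c)) = 0" if c: "chain c" "length c = n + n'" "obstructing c" for c
  proof -
    have "F n' (gen c) \<in> carr (Q n')"
      using gr_hom.carr[of I "Q (n + n')" "Q n'" "- m" "F n'"] gr_module_Q Fh gen_in_carr[OF c(1,2)]
      by (simp add: gr_hom_def gr_hom_axioms_def)
    then have eq: "g (F n' (gen c)) = (\<Sum>p\<in>{p. chain p \<and> length p = n'}. dual p (F n' (gen c)) * g (gen p))"
      by (rule functional_expand[OF g])
    have "dual p (F n' (gen c)) * g (gen p) = 0" if p: "chain p" "length p = n'" for p
    \<comment> \<open>In degree 0 the second factor is a scalar, and the value of the product is that of a multiple of f.\<close>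
    proof (cases n')
      case 0
      then have "p = []" using p by simp
      moreover have "dual [] (F 0 (gen c)) = f (gen c)"
        using lift_coefficient_0[OF \<open>yoneda_lift _ _ _ _ _ _ _\<close> c(1)] c(2) 0 by (simp add: dual_def)
      ultimately show ?thesis using prod.IH c 0 by simp
    next
      case (Suc i)
      then have "dual p (F n' (gen c)) \<noteq> 0 \<Longrightarrow> obstructing p"
        using obstructing_lift[OF \<open>yoneda_lift _ _ _ _ _ _ _\<close> c(1,3)] c(2) p by simp
      then show ?thesis using prod.IH p by auto
    qed
    then show ?thesis unfolding eq by (intro sum.neutral) blast
  qed
  ultimately show ?case by simp
next
  case (cohomologous n m f g)
  then have "ghom (Q n) trivial_module (- m) g" by (simp add: ext_cocycle_def)
  moreover have "g (gen c) = f (gen c)" if "chain c" "length c = n" for c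
    using coboundary_zero[OF cohomologous.hyps(3) gen_in_carr[OF that]] by simp
  ultimately show ?case using cohomologous.IH by simp
qed

lemma K2_no_obstructing_chain:
  assumes "K2 I" "chain c"
  shows "\<not> obstructing c"
proof
  assume "obstructing c"
  have "yoneda_generated Q (\<lambda>_. Q_d) Q_eps {1, 2} (length c) (wt c) (dual c)"
    using assms(1) resolution_Q cocycle_dual unfolding K2_def by blast
  then have "dual c (gen c) = 0"
    using generated_vanishes_on_obstructing \<open>obstructing c\<close> assms(2) by blast
  then show False by (simp add: dual_gen)
qed

lemma lift_exists:
  assumes "ext_cocycle Q (\<lambda>_. Q_d) n m f"
  obtains F where "yoneda_lift Q (\<lambda>_. Q_d) Q_eps n m f F"
proof -
  obtain F where "\<And>i. ghom (Q (n + i)) (Q i) (- m) (F i)"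
    "\<And>p. p \<in> carr (Q (n + 0)) \<Longrightarrow> Q_eps (F 0 p) = f p"
    "\<And>i p. p \<in> carr (Q (n + Suc i)) \<Longrightarrow> Q_d (F (Suc i) p) = F i (Q_d p)"
  proof (rule chain_map_exists[OF augmentation_ideal resolution_Q, of "\<lambda>i. Q (n + i)" "\<lambda>_. Q_d" "- m" f])
    show "ghom (Q (n + 0)) trivial_module (- m) f" "\<And>p. p \<in> carr (Q (n + Suc 0)) \<Longrightarrow> f (Q_d p) = 0"
      using assms by (simp_all add: ext_cocycle_def)
  qed (auto simp: projective_Q ghom_Q_d Q_d_Q_d)
  then show ?thesis
    using that[of F] by (simp add: yoneda_lift_def)
qed

text \<open>A scalar coefficient at the chain \<open>[a]\<close> can only come from a chain \<open>y # q\<close> with \<open>y\<close> a left end of the letter \<open>a\<close>,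
i.e. \<open>y = a\<close>, and it is then the value of \<open>dual c\<close> at \<open>q\<close>.\<close>

lemma product_with_letter:
  assumes F: "yoneda_lift Q (\<lambda>_. Q_d) Q_eps (length c) (wt c) (dual c) F"
    and "chain (a # c)" "length a = 1" "p \<in> carr (Q (Suc (length c)))"
  shows "dual [a] (F (Suc 0) p) = dual (a # c) p"
proof (rule functional_eqI[OF _ ghom_dual _ assms(4)])
  show "ghom (Q (Suc (length c))) trivial_module (- wt c + - wt [a]) (\<lambda>p. dual [a] (F (Suc 0) p))"
    using ghom_compose[OF gr_module_Q gr_module_Q lift_ghom[OF F, of "Suc 0"] ghom_dual] by simp
  fix p assume p: "chain p" "length p = Suc (length c)"
  then obtain y q where yq: "p = y # q" "length q = length c" by (cases p) auto
  have y: "y \<noteq> []" using chain_hd p(1) yq by blast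
  have q: "chain q" using chain_tl p(1) yq by blast
  have chs: "chain (y # q)" "chain [a]" using p(1) yq assms(3) by simp_all
  have na: "\<not> vanishing ([] @ a)" using not_vanishing_short[of a] assms(3) by simp
  show "dual [a] (F (Suc 0) (gen p)) = dual (a # c) (gen p)"
  proof (cases "y = a")
    case True
    have "dual [a] (F (Suc 0) (gen p)) = dual [] (F 0 (gen q))"
      using lift_coefficient(1)[OF F chs(1) _ chs(2) na, of 0 "[]"] True yq by (simp add: dual_def)
    also have "\<dots> = dual c (gen q)"
      using lift_coefficient_0[OF F q] yq by (simp add: dual_def)
    finally show ?thesis using True by (simp add: dual_gen yq)
  next
    case False
    have "dual [a] (F (Suc 0) (gen p)) = 0"
    proof (rule ccontr)
      assume "dual [a] (F (Suc 0) (gen p)) \<noteq> 0"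
      then obtain v where v: "a = y @ v"
        using lift_coefficient(2)[OF F chs(1) _ chs(2) na, of 0] yq by (auto simp: dual_def)
      then have "v = []" using assms(3) y by (cases y) auto
      then show False using v False by simp
    qed
    then show ?thesis using False by (simp add: dual_gen yq)
  qed
qed

text \<open>Write the relation as \<open>a b = a' x\<close> with a letter \<open>x\<close>. By two steps of the recursion, the chain \<open>y # z # q\<close> has a
scalar coefficient at \<open>[a', [x]]\<close> only if \<open>y z\<close> is a left end of \<open>a b\<close>. As \<open>y z\<close> vanishes in \<open>A\<close>, it is
then equal to the relation, and the coefficient is the value of \<open>dual c\<close> at \<open>q\<close>. For \<open>q = c\<close> the
uniqueness of extensions forces \<open>z = b\<close>.\<close>

lemma product_with_relation:
  assumes F: "yoneda_lift Q (\<lambda>_. Q_d) Q_eps (length c) (wt c) (dual c) F"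
    and "chain (a # b # c)" "a @ b \<in> R" "a @ b = a' @ [x]" "p \<in> carr (Q (Suc (Suc (length c))))"
  shows "dual [a', [x]] (F (Suc (Suc 0)) p) = dual (a # b # c) p"
    and "chain [a', [x]]"
proof -
  have proper: "\<not> vanishing w" if "sublist w (a @ b)" "w \<noteq> a @ b" for w
  proof
    assume "vanishing w"
    then obtain r where r: "r \<in> R" "sublist r w" by (auto simp: vanishing_def)
    then have "r = a @ b" using antichain assms(3) that(1) sublist_order.order_trans by blast
    then show False using r(2) that sublist_order.order_antisym by blast
  qed
  have ab: "a \<noteq> []" "b \<noteq> []"
    using chain_hd[OF assms(2)] chain_hd[of b c] assms(2) by auto
  have a': "\<not> vanishing a'"
    by (rule proper) (auto simp: assms(4))
  have "strict_suffix y' a' \<Longrightarrow> \<not> vanishing (y' @ [x])" for y'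
    by (rule proper) (auto simp: assms(4) strict_suffix_def suffix_def)
  moreover have "vanishing (a' @ [x])"
    using assms(3,4) by (auto simp: vanishing_def)
  ultimately show ch: "chain [a', [x]]"
    using a' by (simp add: min_ann_def)
  show "dual [a', [x]] (F (Suc (Suc 0)) p) = dual (a # b # c) p"
  proof (rule functional_eqI[OF _ ghom_dual _ assms(5)])
    show "ghom (Q (Suc (Suc (length c)))) trivial_module (- wt c + - wt [a', [x]]) (\<lambda>p. dual [a', [x]] (F (Suc (Suc 0)) p))"
      using ghom_compose[OF gr_module_Q gr_module_Q lift_ghom[OF F, of "Suc (Suc 0)"] ghom_dual] by simp
    fix p assume p: "chain p" "length p = Suc (Suc (length c))"
    then obtain y z q where yzq: "p = y # z # q" "length q = length c"
      by (auto simp: length_Suc_conv)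
    have chs: "chain (y # z # q)" "chain (z # q)" "chain [[x]]" "chain q"
      using p(1) yzq chain_tl[of z q] by auto
    have nz: "y \<noteq> []" "z \<noteq> []" using chain_hd chs by blast+
    have eq: "dual [a', [x]] (F (Suc (Suc 0)) (gen p)) = (if y @ z = a @ b then dual c (gen q) else 0)"
    proof (cases "\<exists>v. a' = y @ v")
      case False
      then have "dual [a', [x]] (F (Suc (Suc 0)) (gen p)) = 0"
        using lift_coefficient(2)[OF F chs(1) _ ch, of "Suc 0" "[]"] a' yzq by (auto simp: dual_def)
      moreover have "y @ z \<noteq> a @ b"
      proof
        assume "y @ z = a @ b"
        then have "a' = butlast (y @ z)" by (simp add: assms(4))
        then have "a' = y @ butlast z" using nz(2) by (simp add: butlast_append)
        then show False using False by blast
      qed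
      ultimately show ?thesis by simp
    next
      case True
      then obtain v where v: "a' = y @ v" by blast
      have 1: "dual [a', [x]] (F (Suc (Suc 0)) (gen p)) = lookup (part [[x]] (F (Suc 0) (gen (z # q)))) v"
        using lift_coefficient(1)[OF F chs(1) _ ch, of "Suc 0" "[]" v] a' v yzq by (simp add: dual_def)
      have abv: "a @ b = y @ v @ [x]" using assms(4) v by simp
      have vx: "\<not> vanishing (v @ [x])"
        by (rule proper) (use nz in \<open>auto simp: abv\<close>)
      show ?thesis
      proof (cases "\<exists>u. v @ [x] = z @ u")
        case False
        then have "lookup (part [[x]] (F (Suc 0) (gen (z # q)))) v = 0"
          using lift_coefficient(2)[OF F chs(2) _ chs(3) vx, of 0] yzq by auto
        moreover have "y @ z \<noteq> a @ b" using False abv by auto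
        ultimately show ?thesis using 1 by simp
      next
        case True
        then obtain u where u: "v @ [x] = z @ u" by blast
        have "vanishing (y @ z)" using chs(1) by (simp add: min_ann_def)
        moreover have "sublist (y @ z) (a @ b)"
          unfolding abv u by (metis append.assoc sublist_append_rightI)
        ultimately have yz: "y @ z = a @ b" using proper by blast
        then have "u = []" using abv u by simp
        then have "lookup (part [[x]] (F (Suc 0) (gen (z # q)))) v = dual [] (F 0 (gen q))"
          using lift_coefficient(1)[OF F chs(2) _ chs(3) vx, of 0 u] yzq u by (simp add: dual_def)
        also have "\<dots> = dual c (gen q)"
          using lift_coefficient_0[OF F chs(4)] yzq by (simp add: dual_def)
        finally show ?thesis using 1 yz by simp
      qed
    qed
    have "z = b \<and> y = a" if "y @ z = a @ b" "q = c"
    proof -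
      have "z = b" by (rule chain_suffix_unique[of z c b y a]) (use that chs(2) assms(2) in auto)
      then show ?thesis using that by simp
    qed
    then show "dual [a', [x]] (F (Suc (Suc 0)) (gen p)) = dual (a # b # c) (gen p)"
      unfolding eq by (auto simp: dual_gen yzq)
  qed
qed

section \<open>Transfer to an arbitrary resolution\<close>

text \<open>Let \<open>\<phi>\<close> and \<open>\<psi>\<close> be chain maps from \<open>P\<close> to the minimal resolution and back. A lift \<open>F\<close> on the minimal
resolution becomes a lift on \<open>P\<close> after composition with \<open>\<psi>\<close> and \<open>\<phi>\<close>, and functionals on the minimal
resolution do not notice \<open>\<phi> \<circ> \<psi>\<close>, which is homotopic to the identity. So products of dual functionals can be
computed on the minimal resolution. Since \<open>\<psi> \<circ> \<phi>\<close> is homotopic to the identity of \<open>P\<close>, a cocycle \<open>f\<close> is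
cohomologous to \<open>f \<circ> \<psi> \<circ> \<phi>\<close>, and this is a linear combination of dual functionals pulled back along
\<open>\<phi>\<close>.\<close>

lemma cocycles_generated:
  fixes P :: "nat \<Rightarrow> ('x, 'k, nat \<Rightarrow>\<^sub>0 'k) gmod"
  assumes no_obstruction: "\<And>c. chain c \<Longrightarrow> \<not> obstructing c"
    and res: "projective_resolution I P d \<epsilon>"
    and f: "ext_cocycle P d n m f"
  shows "yoneda_generated P d \<epsilon> {1, 2} n m f"
proof -
  note P = projective_resolutionD[OF res]
  note Q_res = projective_resolutionD[OF resolution_Q]
  obtain \<phi> where \<phi>: "\<And>i. ghom (P i) (Q i) 0 (\<phi> i)" "\<And>p. p \<in> carr (P 0) \<Longrightarrow> Q_eps (\<phi> 0 p) = \<epsilon> p"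
    "\<And>i p. p \<in> carr (P (Suc i)) \<Longrightarrow> Q_d (\<phi> (Suc i) p) = \<phi> i (d i p)"
  proof (rule chain_map_exists[OF augmentation_ideal resolution_Q P(1,4,10,5,9)])
    fix F assume "\<And>i. ghom (P i) (Q i) 0 (F i)" "\<And>p. p \<in> carr (P 0) \<Longrightarrow> Q_eps (F 0 p) = \<epsilon> p"
      "\<And>i p. p \<in> carr (P (Suc i)) \<Longrightarrow> Q_d (F (Suc i) p) = F i (d i p)"
    then show thesis by (rule that)
  qed
  obtain \<psi> where \<psi>: "\<And>i. ghom (Q i) (P i) 0 (\<psi> i)" "\<And>p. p \<in> carr (Q 0) \<Longrightarrow> \<epsilon> (\<psi> 0 p) = Q_eps p"
    "\<And>i p. p \<in> carr (Q (Suc i)) \<Longrightarrow> d i (\<psi> (Suc i) p) = \<psi> i (Q_d p)"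
  proof (rule chain_map_exists[OF augmentation_ideal res Q_res(1,4,10,5,9)])
    fix F assume "\<And>i. ghom (Q i) (P i) 0 (F i)" "\<And>p. p \<in> carr (Q 0) \<Longrightarrow> \<epsilon> (F 0 p) = Q_eps p"
      "\<And>i p. p \<in> carr (Q (Suc i)) \<Longrightarrow> d i (F (Suc i) p) = F i (Q_d p)"
    then show thesis by (rule that)
  qed
  interpret \<phi>: gr_hom I "P i" "Q i" 0 "\<phi> i" for i
    using P(2) gr_module_Q \<phi>(1) by (simp add: gr_hom_def gr_hom_axioms_def)
  interpret \<psi>: gr_hom I "Q i" "P i" 0 "\<psi> i" for i
    using P(2) gr_module_Q \<psi>(1) by (simp add: gr_hom_def gr_hom_axioms_def)
  interpret Q_d: gr_hom I "Q (Suc i)" "Q i" 0 "Q_d" for i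
    using gr_module_Q ghom_Q_d by (simp add: gr_hom_def gr_hom_axioms_def)
  interpret d: gr_hom I "P (Suc i)" "P i" 0 "d i" for i
    using P(2,4) by (simp add: gr_hom_def gr_hom_axioms_def)
  have id: "ghom M M 0 (\<lambda>p. p)" for M :: "('x, 'k, nat \<Rightarrow>\<^sub>0 'k) gmod"
    by (auto simp: ghom_def)
  have \<phi>\<psi>: "ghom (Q i) (Q i) 0 (\<lambda>p. \<phi> i (\<psi> i p))" for i
    using ghom_compose[OF gr_module_Q P(2) \<psi>(1) \<phi>(1)] by simp
  have \<psi>\<phi>: "ghom (P i) (P i) 0 (\<lambda>p. \<psi> i (\<phi> i p))" for i
    using ghom_compose[OF P(2) gr_module_Q \<phi>(1) \<psi>(1)] by simp
  have retract: "dual c (\<phi> i (\<psi> i p)) = dual c p" if "p \<in> carr (Q i)" for c i p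
  proof -
    have "ext_coboundary Q (\<lambda>_. Q_d) i (wt c) (\<lambda>p. dual c (\<phi> i (\<psi> i p)) - dual c p)"
      by (rule chain_maps_cohomologous[OF augmentation_ideal resolution_Q Q_res(1,4,10) \<phi>\<psi> _ id _ _ cocycle_dual])
        (simp_all add: \<psi>(2) \<psi>(3) \<phi>(2) \<phi>(3) \<psi>.carr)
    then show ?thesis
      using coboundary_zero that by fastforce
  qed
  have cocycle: "ext_cocycle P d i (wt c) (\<lambda>p. dual c (\<phi> i p))" for c i
    unfolding ext_cocycle_def
    using ghom_compose[OF P(2) gr_module_Q \<phi>(1) ghom_dual[of i c]]
    by (simp add: dual_Q_d flip: \<phi>(3))
  have transfer_lift: "yoneda_lift P d \<epsilon> i (wt c) (\<lambda>p. dual c (\<phi> i p)) (\<lambda>j p. \<psi> j (F j (\<phi> (i + j) p)))"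
    if F: "yoneda_lift Q (\<lambda>_. Q_d) Q_eps i (wt c) (dual c) F" for c i F
  proof -
    interpret F: gr_hom I "Q (i + j)" "Q j" "- wt c" "F j" for j
      using gr_module_Q lift_ghom[OF F] by (simp add: gr_hom_def gr_hom_axioms_def)
    show ?thesis
      unfolding yoneda_lift_def
    proof (intro conjI allI ballI)
      fix j
      have "ghom (P (i + j)) (Q j) (0 + - wt c) (\<lambda>p. F j (\<phi> (i + j) p))"
        by (rule ghom_compose[OF P(2) gr_module_Q \<phi>(1) lift_ghom[OF F]])
      from ghom_compose[OF P(2) gr_module_Q this \<psi>(1)]
      show "ghom (P (i + j)) (P j) (- wt c) (\<lambda>p. \<psi> j (F j (\<phi> (i + j) p)))" by simp
    next
      fix p assume "p \<in> carr (P i)"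
      then show "\<epsilon> (\<psi> 0 (F 0 (\<phi> (i + 0) p))) = dual c (\<phi> i p)"
        using F F.carr[of "\<phi> i p" 0] \<phi>.carr by (simp add: \<psi>(2) yoneda_lift_def)
    next
      fix j p assume p: "p \<in> carr (P (i + Suc j))"
      then have \<phi>p: "\<phi> (i + Suc j) p \<in> carr (Q (i + Suc j))" by (rule \<phi>.carr)
      have "d j (\<psi> (Suc j) (F (Suc j) (\<phi> (i + Suc j) p))) = \<psi> j (Q_d (F (Suc j) (\<phi> (i + Suc j) p)))"
        by (rule \<psi>(3)) (rule F.carr[OF \<phi>p])
      also have "Q_d (F (Suc j) (\<phi> (i + Suc j) p)) = F j (Q_d (\<phi> (i + Suc j) p))"
        using F \<phi>p by (simp add: yoneda_lift_def)
      also have "Q_d (\<phi> (i + Suc j) p) = \<phi> (i + j) (d (i + j) p)"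
        using \<phi>(3) p by simp
      finally show "d j (\<psi> (Suc j) (F (Suc j) (\<phi> (i + Suc j) p))) = \<psi> j (F j (\<phi> (i + j) (d (i + j) p)))" .
    qed
  qed
  have product: "yoneda_generated P d \<epsilon> {1, 2} (length c) (wt c) (\<lambda>p. dual c (\<phi> (length c) p))"
    if t: "yoneda_generated P d \<epsilon> {1, 2} (length t) (wt t) (\<lambda>p. dual t (\<phi> (length t) p))"
      and F: "yoneda_lift Q (\<lambda>_. Q_d) Q_eps (length t) (wt t) (dual t) F"
      and e: "length e \<in> {1, 2}" "length c = length t + length e" "wt c = wt t + wt e"
      and eq: "\<And>p. p \<in> carr (Q (length c)) \<Longrightarrow> dual e (F (length e) p) = dual c p" for c t e F
  proof (rule yoneda_generated_cong[OF _ cocycle])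
    have "yoneda_generated P d \<epsilon> {1, 2} (length e) (wt e) (\<lambda>p. dual e (\<phi> (length e) p))"
      using yoneda_generated.gen[OF e(1) cocycle] .
    from yoneda_generated.prod[OF t this transfer_lift[OF F]]
    show "yoneda_generated P d \<epsilon> {1, 2} (length c) (wt c)
        (\<lambda>p. dual e (\<phi> (length e) (\<psi> (length e) (F (length e) (\<phi> (length c) p)))))"
      by (simp add: e)
    fix p assume "p \<in> carr (P (length c))"
    then have \<phi>p: "\<phi> (length c) p \<in> carr (Q (length c))" by (rule \<phi>.carr)
    then have "F (length e) (\<phi> (length c) p) \<in> carr (Q (length e))"
      using gr_hom.carr[of I "Q (length t + length e)" "Q (length e)" "- wt t" "F (length e)"]
        gr_module_Q lift_ghom[OF F] by (simp add: gr_hom_def gr_hom_axioms_def e(2))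
    then show "dual e (\<phi> (length e) (\<psi> (length e) (F (length e) (\<phi> (length c) p)))) = dual c (\<phi> (length c) p)"
      using retract eq[OF \<phi>p] by simp
  qed
  have chains: "yoneda_generated P d \<epsilon> {1, 2} (length c) (wt c) (\<lambda>p. dual c (\<phi> (length c) p))" if "chain c" for c
    using that
  proof (induction c rule: length_induct)
    case (1 c)
    show ?case
    proof (cases "length c \<le> 2")
      case True
      then have "length c = 0 \<or> length c = 1 \<or> length c = 2" by linarith
      then consider "c = []" | "length c \<in> {1, 2}" by auto
      then show ?thesis
      proof cases
        case 1
        have "yoneda_generated P d \<epsilon> {1, 2} 0 0 (\<lambda>p. dual [] (\<phi> 0 p))"
        proof (rule yoneda_generated_cong[OF yoneda_generated.unit])
          show "ext_cocycle P d 0 0 (\<lambda>p. dual [] (\<phi> 0 p))"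
            using cocycle[of 0 "[]"] by (simp add: wt_def)
          show "\<epsilon> p = dual [] (\<phi> 0 p)" if "p \<in> carr (P 0)" for p
            using \<phi>(2)[OF that] by (simp add: Q_eps_def dual_def)
        qed
        then show ?thesis by (simp add: 1 wt_def)
      next
        case 2
        then show ?thesis by (rule yoneda_generated.gen) (rule cocycle)
      qed
    next
      case False
      then obtain a b t where c: "c = a # b # t"
        by (cases c; cases "tl c") auto
      then have tails: "chain (b # t)" "chain t"
        using "1.prems" chain_tl[of b t] by auto
      have "length a \<noteq> 0"
        using chain_hd[of a "b # t"] "1.prems" c by simp
      moreover have "length a < 2 \<or> a @ b \<in> R"
        using no_obstruction[OF "1.prems"] c by (force simp: obstructing_def)
      ultimately consider "length a = 1" | "a @ b \<in> R"
        by linarith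
      then show ?thesis
      proof cases
        case 1
        obtain F where F: "yoneda_lift Q (\<lambda>_. Q_d) Q_eps (length (b # t)) (wt (b # t)) (dual (b # t)) F"
          by (rule lift_exists[OF cocycle_dual])
        show ?thesis
        proof (rule product[OF _ F, of "[a]"])
          show "yoneda_generated P d \<epsilon> {1, 2} (length (b # t)) (wt (b # t)) (\<lambda>p. dual (b # t) (\<phi> (length (b # t)) p))"
            using "1.IH"[rule_format, of "b # t"] c tails(1) by simp
          show "dual [a] (F (length [a]) p) = dual c p" if "p \<in> carr (Q (length c))" for p
            using product_with_letter[OF F _ 1, of p] "1.prems" that c by simp
        qed (auto simp: c wt_def)
      next
        case 2
        obtain F where F: "yoneda_lift Q (\<lambda>_. Q_d) Q_eps (length t) (wt t) (dual t) F"
          by (rule lift_exists[OF cocycle_dual])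
        have "a @ b \<noteq> []" using length_R[OF 2] by auto
        then obtain a' x where ax: "a @ b = a' @ [x]" by (metis rev_exhaust)
        then have "length a + length b = length a' + 1" by (metis length_append length_append_singleton Suc_eq_plus1)
        show ?thesis
        proof (rule product[OF _ F, of "[a', [x]]"])
          show "yoneda_generated P d \<epsilon> {1, 2} (length t) (wt t) (\<lambda>p. dual t (\<phi> (length t) p))"
            using "1.IH"[rule_format, of t] c tails(2) by simp
          show "dual [a', [x]] (F (length [a', [x]]) p) = dual c p" if "p \<in> carr (Q (length c))" for p
            using product_with_relation(1)[OF F _ 2 ax, of p] "1.prems" that c by simp
        qed (use \<open>length a + length b = _\<close> in \<open>auto simp: c wt_def\<close>)
      qed
    qed
  qed
  have f\<psi>: "ghom (Q n) trivial_module (- m) (\<lambda>p. f (\<psi> n p))"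
    using ghom_compose[OF gr_module_Q P(2) \<psi>(1)[of n], of trivial_module "- m" f] f by (simp add: ext_cocycle_def)
  let ?C = "{c. chain c \<and> length c = n}"
  have summand: "yoneda_generated P d \<epsilon> {1, 2} n m (\<lambda>p. f (\<psi> n (gen c)) * dual c (\<phi> n p))" if c: "c \<in> ?C" for c
  proof (cases "wt c = m")
    case True
    then show ?thesis
      using yoneda_generated.scale[OF chains[of c]] c by auto
  next
    case False
    have "f (\<psi> n (gen c)) \<in> piece (trivial_module :: ('x, 'k, 'k) gmod) (wt c + - m)"
      using ghom_piece[OF f\<psi> gen_in_piece[of c n]] c by simp
    then have "f (\<psi> n (gen c)) = 0"
      using False by (simp add: piece_trivial_module)
    then show ?thesis
      by (simp add: yoneda_generated.zero)
  qed
  have "yoneda_generated P d \<epsilon> {1, 2} n m (\<lambda>p. \<Sum>c\<in>?C. f (\<psi> n (gen c)) * dual c (\<phi> n p))"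
    by (rule yoneda_generated_sum[OF finite_chains summand])
  moreover have "ext_cocycle P d n m (\<lambda>p. f (\<psi> n (\<phi> n p)))"
    unfolding ext_cocycle_def
  proof (intro conjI ballI)
    show "ghom (P n) trivial_module (- m) (\<lambda>p. f (\<psi> n (\<phi> n p)))"
      using ghom_compose[OF P(2) P(2) \<psi>\<phi>[of n], of trivial_module "- m" f] f by (simp add: ext_cocycle_def)
    show "f (\<psi> n (\<phi> n (d n p))) = 0" if "p \<in> carr (P (Suc n))" for p
      using f that \<psi>.carr[OF \<phi>.carr[OF that]] \<phi>.carr[OF that]
      by (simp add: ext_cocycle_def flip: \<phi>(3) \<psi>(3))
  qed
  moreover have "(\<Sum>c\<in>?C. f (\<psi> n (gen c)) * dual c (\<phi> n p)) = f (\<psi> n (\<phi> n p))" if "p \<in> carr (P n)" for p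
    using functional_expand[OF f\<psi> \<phi>.carr[OF that]] by (simp add: mult.commute)
  ultimately have "yoneda_generated P d \<epsilon> {1, 2} n m (\<lambda>p. f (\<psi> n (\<phi> n p)))"
    by (rule yoneda_generated_cong)
  moreover have "ext_coboundary P d n m (\<lambda>p. f p - f (\<psi> n (\<phi> n p)))"
  proof (rule chain_maps_cohomologous[where X = P and Y = P and dX = d and dY = d
        and \<alpha> = "\<lambda>_ p. p" and \<beta> = "\<lambda>i p. \<psi> i (\<phi> i p)", OF augmentation_ideal res P(1,4,10) id _ \<psi>\<phi> _ _ f])
    show "d i (\<psi> (Suc i) (\<phi> (Suc i) p)) = \<psi> i (\<phi> i (d i p))" if "p \<in> carr (P (Suc i))" for i p
      using \<psi>(3)[OF \<phi>.carr[OF that]] \<phi>(3)[OF that] by simp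
    show "\<epsilon> p = \<epsilon> (\<psi> 0 (\<phi> 0 p))" if "p \<in> carr (P 0)" for p
      using \<psi>(2)[OF \<phi>.carr[OF that]] \<phi>(2)[OF that] by simp
  qed auto
  ultimately show ?thesis
    using yoneda_generated.cohomologous[OF _ f] by blast
qed

lemma K2_iff_no_obstructing_chain:
  "K2 I \<longleftrightarrow> (\<forall>c. chain c \<longrightarrow> \<not> obstructing c)"
proof
  show "K2 I \<Longrightarrow> \<forall>c. chain c \<longrightarrow> \<not> obstructing c"
    using K2_no_obstructing_chain by blast
  show "\<forall>c. chain c \<longrightarrow> \<not> obstructing c \<Longrightarrow> K2 I"
    unfolding K2_def using cocycles_generated by blast
qed

lemma no_obstructing_chain_iff:
  "(\<forall>c. chain c \<longrightarrow> \<not> obstructing c) \<longleftrightarrow>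
    (\<forall>b\<in>S I R. \<forall>a\<in>LE R. L I a b = mon a \<longrightarrow> a @ b \<in> R \<or> length a = 1)"
proof
  assume *: "\<forall>c. chain c \<longrightarrow> \<not> obstructing c"
  show "\<forall>b\<in>S I R. \<forall>a\<in>LE R. L I a b = mon a \<longrightarrow> a @ b \<in> R \<or> length a = 1"
  proof (intro ballI impI)
    fix a b assume "b \<in> S I R" and a: "a \<in> LE R" "L I a b = mon a"
    then obtain t where t: "chain (b # t)" by (auto simp: in_S_iff)
    then have c: "chain (a # b # t)"
      using a chain_hd[OF t] by (simp add: min_ann_iff)
    then have "length a \<noteq> 0" using chain_hd by blast
    moreover have "length a < 2 \<or> a @ b \<in> R"
      using *[rule_format, OF c] by (auto simp: obstructing_def)
    ultimately show "a @ b \<in> R \<or> length a = 1" by linarith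
  qed
next
  assume *: "\<forall>b\<in>S I R. \<forall>a\<in>LE R. L I a b = mon a \<longrightarrow> a @ b \<in> R \<or> length a = 1"
  show "\<forall>c. chain c \<longrightarrow> \<not> obstructing c"
  proof (intro allI impI notI)
    fix c assume "chain c" "obstructing c"
    then obtain a b t where abt: "chain (a # b # t)" "length a \<ge> 2" "a @ b \<notin> R"
      unfolding obstructing_def by blast
    then have b: "chain (b # t)" "min_ann a b" by auto
    then have "a \<in> LE R \<and> L I a b = mon a"
      using min_ann_iff chain_hd[OF b(1)] by blast
    moreover have "b \<in> S I R" using b(1) in_S_iff by blast
    ultimately show False using * abt(2,3) by force
  qed
qed

end

theorem theorem5p3:
  fixes I :: "('x::finite, 'k::field) free_alg set"
    and R :: "'x list set"
  assumes "finite R"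
    and "\<forall>r\<in>R. length r \<ge> 2"
    and "minimal_generators I (mon ` R)"
  shows "K2 I \<longleftrightarrow>
    (\<forall>b\<in>S I R. \<forall>a\<in>LE R. L I a b = mon a \<longrightarrow> a @ b \<in> R \<or> length a = 1)"
proof -
  interpret monomial_algebra I R
    using assms by unfold_locales auto
  show ?thesis
    unfolding K2_iff_no_obstructing_chain by (rule no_obstructing_chain_iff)
qed

end
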